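(* Let $n\ge 1$, $\alpha>0$, $p\ge 1$, and let $\mu$ be a positive Borel measure on $\mathbb{C}^n$ such that $\int_{\mathbb{C}^n}|K_{ph,\alpha}(z,w)|^2e^{-|w|^2/\alpha}\,d\mu(w)<\infty$ for every $z\in\mathbb{C}^n$. If the Toeplitz operator $T_\mu$ on $\mathcal{PH}^2_\alpha(\mathbb{C}^n)$ belongs to the Schatten class $S_p$, then for every $r>0$ the function $z\mapsto\mu(B(z,r))$ belongs to $L^p(\mathbb{C}^n,dA)$.
   Context: $dA$ is Lebesgue measure on $\mathbb{C}^n$, $B(z,r)$ is the Euclidean ball of center $z$ and radius $r$, and $z\bar w=\sum_{j=1}^n z_j\overline{w_j}$. A function $f:\mathbb{C}^n\to\mathbb{C}$ is pluriharmonic if $\partial^2 f/\partial z_j\partial\bar z_k=0$ for all $j,k$; equivalently $f=g+\bar h$ with $g,h$ entire. $\mathcal{PH}^2_\alpha(\mathbb{C}^n)$ is the Hilbert space of pluriharmonic functions $f$ with $\|f\|_{2,\alpha}^2=\frac{1}{(\alpha\pi)^n}\int_{\mathbb{C}^n}|f(z)|^2e^{-|z|^2/\alpha}\,dA(z)<\infty$, with inner product $\langle f,g\rangle=\frac{1}{(\alpha\pi)^n}\int f\bar g\,e^{-|z|^2/\alpha}\,dA$ and reproducing kernel $K_{ph,\alpha}(z,w)=e^{z\bar w/\alpha}+e^{\bar z w/\alpha}-1$. The Toeplitz operator with symbol $\mu$ is $T_\mu f(z)=\int_{\mathbb{C}^n}K_{ph,\alpha}(z,w)f(w)e^{-|w|^2/\alpha}\,d\mu(w)$,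 which is defined at least for $f$ in the linear span of the kernels $K_{ph,\alpha}(\cdot,w)$, $w\in\mathbb{C}^n$ (a dense subspace of $\mathcal{PH}^2_\alpha(\mathbb{C}^n)$). "$T_\mu\in S_p$" means that $T_\mu$ extends to a bounded operator on $\mathcal{PH}^2_\alpha(\mathbb{C}^n)$ which belongs to the Schatten class $S_p$ (singular values in $\ell^p$). *)

theory Defs
  imports "HOL-Analysis.Analysis"
begin

definition wirtinger :: "'n::finite \<Rightarrow> (complex^'n \<Rightarrow> complex) \<Rightarrow> complex^'n \<Rightarrow> complex" where
  "wirtinger j f z =
     (frechet_derivative f (at z) (axis j 1) - \<i> * frechet_derivative f (at z) (axis j \<i>)) / 2"

definition wirtinger_bar :: "'n::finite \<Rightarrow> (complex^'n \<Rightarrow> complex) \<Rightarrow> complex^'n \<Rightarrow> complex" where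
  "wirtinger_bar j f z =
     (frechet_derivative f (at z) (axis j 1) + \<i> * frechet_derivative f (at z) (axis j \<i>)) / 2"

text \<open>Twice continuously differentiable in the real sense. The library's \<^const>\<open>frechet_derivative\<close>
  is an arbitrary choice where no derivative exists, so differentiability is demanded explicitly.\<close>

definition C2 :: "('a::euclidean_space \<Rightarrow> 'b::real_normed_vector) \<Rightarrow> bool" where
  "C2 f \<longleftrightarrow>
     (\<forall>x. f differentiable at x) \<and>
     (\<forall>v x. (\<lambda>y. frechet_derivative f (at y) v) differentiable at x) \<and>
     (\<forall>u v. continuous_on UNIV
        (\<lambda>x. frechet_derivative (\<lambda>y. frechet_derivative f (at y) v) (at x) u))"

definition pluriharmonic :: "(complex^'n::finite \<Rightarrow> complex) \<Rightarrow> bool" where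
  "pluriharmonic f \<longleftrightarrow> C2 f \<and> (\<forall>j k z. wirtinger j (wirtinger_bar k f) z = 0)"

definition ph_inner ::
  "real \<Rightarrow> (complex^'n::finite \<Rightarrow> complex) \<Rightarrow> (complex^'n \<Rightarrow> complex) \<Rightarrow> complex" where
  "ph_inner \<alpha> f g =
     of_real (1 / (\<alpha> * pi) ^ CARD('n)) *
     (LINT z|lborel. f z * cnj (g z) * of_real (exp (- (norm z)\<^sup>2 / \<alpha>)))"

definition PH2 :: "real \<Rightarrow> (complex^'n::finite \<Rightarrow> complex) set" where
  "PH2 \<alpha> = {f. pluriharmonic f \<and>
     integrable lborel (\<lambda>z. (norm (f z))\<^sup>2 * exp (- (norm z)\<^sup>2 / \<alpha>))}"

definition herm :: "complex^'n::finite \<Rightarrow> complex^'n \<Rightarrow> complex" where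
  "herm z w = (\<Sum>j\<in>UNIV. z $ j * cnj (w $ j))"

text \<open>\<open>herm w z\<close> is the conjugate of \<open>herm z w\<close>.\<close>

definition K_ph :: "real \<Rightarrow> complex^'n::finite \<Rightarrow> complex^'n \<Rightarrow> complex" where
  "K_ph \<alpha> z w = exp (herm z w / of_real \<alpha>) + exp (herm w z / of_real \<alpha>) - 1"

definition kernel_span :: "real \<Rightarrow> (complex^'n::finite \<Rightarrow> complex) set" where
  "kernel_span \<alpha> = {f. \<exists>S c. finite S \<and> f = (\<lambda>z. \<Sum>w\<in>S. c w * K_ph \<alpha> z w)}"

text \<open>Below, \<open>H\<close> is a complex vector space of functions and \<open>ip\<close> an inner product on it;
  an operator is a map of functions of which only the restriction to \<open>H\<close> matters.\<close>

definition ip_norm :: "('f \<Rightarrow> 'f \<Rightarrow> complex) \<Rightarrow> 'f \<Rightarrow> real" where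
  "ip_norm ip f = sqrt (Re (ip f f))"

definition bounded_operator_on ::
  "('a \<Rightarrow> complex) set \<Rightarrow> (('a \<Rightarrow> complex) \<Rightarrow> ('a \<Rightarrow> complex) \<Rightarrow> complex) \<Rightarrow>
   (('a \<Rightarrow> complex) \<Rightarrow> ('a \<Rightarrow> complex)) \<Rightarrow> bool" where
  "bounded_operator_on H ip T \<longleftrightarrow>
     (\<forall>f\<in>H. T f \<in> H) \<and>
     (\<forall>f\<in>H. \<forall>g\<in>H. T (\<lambda>x. f x + g x) = (\<lambda>x. T f x + T g x)) \<and>
     (\<forall>c. \<forall>f\<in>H. T (\<lambda>x. c * f x) = (\<lambda>x. c * T f x)) \<and>
     (\<exists>C. \<forall>f\<in>H. ip_norm ip (T f) \<le> C * ip_norm ip f)"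

definition orthonormal_family ::
  "'f set \<Rightarrow> ('f \<Rightarrow> 'f \<Rightarrow> complex) \<Rightarrow> 'i set \<Rightarrow> ('i \<Rightarrow> 'f) \<Rightarrow> bool" where
  "orthonormal_family H ip I e \<longleftrightarrow>
     (\<forall>k\<in>I. e k \<in> H) \<and> (\<forall>k\<in>I. \<forall>l\<in>I. ip (e k) (e l) = (if k = l then 1 else 0))"

text \<open>The singular values of a compact operator are the coefficients \<open>s\<^sub>0 \<ge> s\<^sub>1 \<ge> \<dots> \<rightarrow> 0\<close> of its
  canonical (Schmidt) form \<open>T g = \<Sum>k. s\<^sub>k \<langle>g, e\<^sub>k\<rangle> u\<^sub>k\<close> with \<open>(e\<^sub>k)\<close> and \<open>(u\<^sub>k)\<close> orthonormal, the
  series converging in the norm of \<open>H\<close>; an operator of this form is compact. A finite-rank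
  operator has \<open>s\<^sub>k = 0\<close> from some point on, and \<open>e\<^sub>k\<close>, \<open>u\<^sub>k\<close> are then irrelevant.\<close>

definition has_singular_values ::
  "('a \<Rightarrow> complex) set \<Rightarrow> (('a \<Rightarrow> complex) \<Rightarrow> ('a \<Rightarrow> complex) \<Rightarrow> complex) \<Rightarrow>
   (('a \<Rightarrow> complex) \<Rightarrow> ('a \<Rightarrow> complex)) \<Rightarrow> (nat \<Rightarrow> real) \<Rightarrow> bool" where
  "has_singular_values H ip T s \<longleftrightarrow>
     (\<forall>k. 0 \<le> s k) \<and> decseq s \<and> s \<longlonglongrightarrow> 0 \<and>
     (\<exists>e u. orthonormal_family H ip {k. s k \<noteq> 0} e \<and>
            orthonormal_family H ip {k. s k \<noteq> 0} u \<and>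
            (\<forall>g\<in>H. (\<lambda>N. ip_norm ip
               (\<lambda>x. T g x - (\<Sum>k | k < N \<and> s k \<noteq> 0. of_real (s k) * ip g (e k) * u k x)))
               \<longlonglongrightarrow> 0))"

definition schatten_class ::
  "('a \<Rightarrow> complex) set \<Rightarrow> (('a \<Rightarrow> complex) \<Rightarrow> ('a \<Rightarrow> complex) \<Rightarrow> complex) \<Rightarrow> real \<Rightarrow>
   (('a \<Rightarrow> complex) \<Rightarrow> ('a \<Rightarrow> complex)) set" where
  "schatten_class H ip p =
     {T. bounded_operator_on H ip T \<and>
         (\<exists>s. has_singular_values H ip T s \<and> summable (\<lambda>k. s k powr p))}"

definition toeplitz ::
  "real \<Rightarrow> (complex^'n::finite) measure \<Rightarrow> (complex^'n \<Rightarrow> complex) \<Rightarrow> complex^'n \<Rightarrow> complex" where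
  "toeplitz \<alpha> \<mu> f z =
     (LINT w|\<mu>. K_ph \<alpha> z w * f w * of_real (exp (- (norm w)\<^sup>2 / \<alpha>)))"

definition toeplitz_in_schatten :: "real \<Rightarrow> (complex^'n::finite) measure \<Rightarrow> real \<Rightarrow> bool" where
  "toeplitz_in_schatten \<alpha> \<mu> p \<longleftrightarrow>
     (\<exists>T\<in>schatten_class (PH2 \<alpha>) (ph_inner \<alpha>) p. \<forall>f\<in>kernel_span \<alpha>. T f = toeplitz \<alpha> \<mu> f)"

text \<open>Membership in $L^p$ (for finite \<open>p\<close>) of a function with values in $[0,\infty]$.\<close>

definition in_Lp :: "real \<Rightarrow> 'a measure \<Rightarrow> ('a \<Rightarrow> ennreal) \<Rightarrow> bool" where
  "in_Lp p M f \<longleftrightarrow>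
     f \<in> borel_measurable M \<and> (AE x in M. f x < \<infinity>) \<and>
     (\<integral>\<^sup>+x. ennreal (enn2real (f x) powr p) \<partial>M) < \<infinity>"

end

theory Submission
  imports Defs "HOL-Probability.Distributions"
begin

text \<open>
  Since \<open>T\<close> is in the Schatten class, its Schmidt expansion, Bessel's inequality and Jensen's
  inequality bound \<open>|\<langle>T K\<^sub>y, K\<^sub>y\<rangle>| ^ p\<close> by \<open>\<parallel>K\<^sub>y\<parallel> ^ (2 * p - 2)\<close> times the sum of
  \<open>s\<^sub>k ^ p * (|\<langle>K\<^sub>y, e\<^sub>k\<rangle>|\<^sup>2 + |\<langle>K\<^sub>y, u\<^sub>k\<rangle>|\<^sup>2)\<close>. By Schur's test the Gaussian-weighted
  \<open>|\<langle>K\<^sub>y, e\<^sub>k\<rangle>|\<^sup>2\<close> is dominated by an integrable function of \<open>z\<close>, uniformly in \<open>y\<close> at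
  distance at most 1 from \<open>z\<close>. Hence the Berezin transform, even when evaluated at a displaced
  point, has a dominating function in \<open>L\<^sup>p\<close>.

  The Berezin transform at \<open>z\<close> does not control \<open>\<mu> (ball z r)\<close>, because the kernel vanishes at
  points close to \<open>z\<close>. For large \<open>z\<close> one adds its value at a nearby point \<open>y\<close> for which the
  phase of the kernel is shifted by a quarter of a period; for bounded \<open>z\<close> local finiteness of
  \<open>\<mu>\<close> suffices.

  The identity \<open>\<langle>T K\<^sub>z, K\<^sub>z\<rangle> = \<integral> |K\<^sub>z|\<^sup>2 d\<mu>\<close> (weights and constants suppressed) needs no general
  reproducing formula: one truncates the inner product to balls, applies Fubini's theorem, and
  bounds the truncated inner products of two kernels by circle averaging.
\<close>

section \<open>The Hermitian form and the kernel\<close>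

text \<open>The obstacle is Fubini's theorem on the whole space. Taking absolute values, the
  Gaussian integral over \<open>v\<close> of the product of the kernels at \<open>w\<close> and
  \<open>z\<close> is estimated by about exp(|w + z|^2 / (4 \<alpha>)), which is quadratic in
  \<open>w\<close> in the exponent. The hypothesis on \<mu> yields integrability of exp(c |w|)
  against the weight for every c, and nothing quadratic. Hence \<open>v\<close> is first confined to
  a ball, where the joint integrand has linear exponents, and the ball is then exhausted. The limit
  needs a bound uniform in the radius and again linear in |w| in the exponent; it comes from
  cancellation under the rotations \<open>c *s v\<close>, which balls respect.

  Even the linear exponents are not immediate from the hypothesis, since the kernel oscillates. They
  follow by combining the kernels at z and at 2z, whose cosines are never small together.

  The displaced point \<open>y\<close> is picked separately for each \<open>z\<close>, with no
  measurable dependence on it. Therefore one function of \<open>z\<close> has to dominate the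
  Berezin transform at all points within distance 1.\<close>

lemma Re_herm: "Re (herm z w) = z \<bullet> w"
  by (simp add: herm_def inner_vec_def inner_complex_def)

lemma cnj_herm: "cnj (herm z w) = herm w z"
  by (simp add: herm_def mult.commute)

lemma norm_herm_le: "norm (herm z w) \<le> norm z * norm w"
proof -
  have "norm (herm z w) \<le> (\<Sum>j\<in>UNIV. \<bar>norm (z $ j)\<bar> * \<bar>norm (w $ j)\<bar>)"
    unfolding herm_def by (rule order_trans[OF norm_sum]) (simp add: norm_mult)
  also have "\<dots> \<le> norm z * norm w"
    unfolding norm_vec_def by (rule L2_set_mult_ineq)
  finally show ?thesis .
qed

lemma herm_add_left: "herm (x + y) w = herm x w + herm y w"
  and herm_add_right: "herm w (x + y) = herm w x + herm w y"
  by (simp_all add: herm_def algebra_simps sum.distrib)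

lemma herm_smult_left: "herm (c *s x) w = c * herm x w"
  and herm_smult_right: "herm w (c *s x) = cnj c * herm w x"
  by (simp_all add: herm_def algebra_simps sum_distrib_left)

lemma herm_scaleR_left: "herm (r *\<^sub>R x) w = of_real r * herm x w"
  and herm_scaleR_right: "herm w (r *\<^sub>R x) = of_real r * herm w x"
  by (simp_all add: herm_def algebra_simps sum_distrib_left scaleR_conv_of_real[where 'a=complex])

lemma herm_zero_left [simp]: "herm 0 w = 0"
  and herm_zero_right [simp]: "herm w 0 = 0"
  by (simp_all add: herm_def)

lemma herm_self: "herm z z = of_real ((norm z)\<^sup>2)"
  by (simp add: complex_eq_iff Re_herm power2_norm_eq_inner)
     (metis Reals_cnj_iff cnj_herm complex_is_Real_iff)

lemma bounded_linear_herm_left: "bounded_linear (\<lambda>z. herm z w)"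
  by (rule bounded_linear_intro[where K = "norm w"])
     (simp_all add: herm_add_left herm_scaleR_left scaleR_conv_of_real[where 'a=complex] norm_herm_le)

lemma bounded_linear_herm_right: "bounded_linear (\<lambda>z. herm w z)"
  by (rule bounded_linear_intro[where K = "norm w"])
     (auto simp: herm_add_right herm_scaleR_right scaleR_conv_of_real[where 'a=complex] mult.commute
           intro: order_trans[OF norm_herm_le])

lemma continuous_on_herm [continuous_intros]:
  assumes "continuous_on A f" "continuous_on A g"
  shows "continuous_on A (\<lambda>x. herm (f x) (g x))"
  unfolding herm_def using assms by (intro continuous_intros)

lemma borel_measurable_herm [measurable]:
  fixes f g :: "'a \<Rightarrow> complex^'n::finite"
  assumes [measurable]: "f \<in> borel_measurable M" "g \<in> borel_measurable M"
  shows "(\<lambda>x. herm (f x) (g x)) \<in> borel_measurable M"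
proof -
  have "continuous_on UNIV (\<lambda>p::(complex^'n) \<times> (complex^'n). herm (fst p) (snd p))"
    by (intro continuous_intros)
  then have "(\<lambda>p::(complex^'n) \<times> (complex^'n). herm (fst p) (snd p)) \<in> borel_measurable borel"
    by (rule borel_measurable_continuous_onI)
  then have "(\<lambda>x. herm (fst (f x, g x)) (snd (f x, g x))) \<in> borel_measurable M"
    by (rule measurable_compose[rotated])
       (simp add: borel_prod[symmetric])
  then show ?thesis by simp
qed

lemma norm_smult_vec: "norm (c *s (z :: complex^'n::finite)) = norm c * norm z"
  by (simp add: norm_vec_def norm_mult L2_set_right_distrib)

lemma borel_measurable_K_ph [measurable]:
  fixes f g :: "'a \<Rightarrow> complex^'n::finite"
  assumes [measurable]: "f \<in> borel_measurable M" "g \<in> borel_measurable M"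
  shows "(\<lambda>x. K_ph \<alpha> (f x) (g x)) \<in> borel_measurable M"
  unfolding K_ph_def by measurable

text \<open>The two exponentials are complex conjugates. The cosine is the source of the zeros of
  the kernel, and realness removes the conjugate from every inner product with a kernel.\<close>

lemma K_ph_real:
  "K_ph \<alpha> z w = of_real (2 * exp (z \<bullet> w / \<alpha>) * cos (Im (herm z w) / \<alpha>) - 1)"
proof -
  have "herm w z = cnj (herm z w)"
    by (simp add: cnj_herm)
  then show ?thesis
    by (simp add: K_ph_def complex_eq_iff Re_exp Im_exp Re_herm)
qed

lemma K_ph_commute: "K_ph \<alpha> z w = K_ph \<alpha> w z"
  by (simp add: K_ph_def add.commute)

lemma cnj_K_ph [simp]: "cnj (K_ph \<alpha> z w) = K_ph \<alpha> z w"
  by (simp add: K_ph_real)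

lemma norm_K_ph_le: "norm (K_ph \<alpha> z w) \<le> 2 * exp (z \<bullet> w / \<alpha>) + 1"
proof -
  have "\<bar>2 * exp (z \<bullet> w / \<alpha>) * cos (Im (herm z w) / \<alpha>)\<bar> \<le> 2 * exp (z \<bullet> w / \<alpha>)"
    by (simp add: abs_mult)
  then show ?thesis
    unfolding K_ph_real norm_of_real by linarith
qed

section \<open>Gaussian weights\<close>

text \<open>The scale stays a parameter because several occur: \<open>2 * \<alpha>\<close> gives the
  square root of the weight, and \<open>8 * \<alpha>\<close> and \<open>16 * \<alpha>\<close> serve
  in the smoothing estimate.\<close>

definition gauss :: "real \<Rightarrow> 'a::euclidean_space \<Rightarrow> real" where
  "gauss \<alpha> v = exp (- (norm v)\<^sup>2 / \<alpha>)"

lemma gauss_pos [simp]: "gauss \<alpha> v > 0"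
  and gauss_nonneg [simp]: "gauss \<alpha> v \<ge> 0"
  by (simp_all add: gauss_def)

lemma gauss_measurable [measurable]:
  assumes [measurable]: "f \<in> borel_measurable M"
  shows "(\<lambda>x. gauss \<alpha> (f x)) \<in> borel_measurable M"
  unfolding gauss_def by measurable

lemma integrable_gauss:
  assumes "\<alpha> > 0"
  shows "integrable lborel (gauss \<alpha> :: 'a::euclidean_space \<Rightarrow> real)"
proof (rule integrableI_bounded)
  let ?f = "\<lambda>(b::'a) x::real. exp (- x\<^sup>2 / \<alpha>)"
  have 1: "gauss \<alpha> v = (\<Prod>b\<in>Basis. ?f b (v \<bullet> b))" for v :: 'a
    by (simp add: gauss_def exp_sum[symmetric] euclidean_inner[of v v] power2_eq_square
        power2_norm_eq_inner[unfolded power2_eq_square] sum_divide_distrib sum_negf)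
  \<comment> \<open>The exponent of a normal density with standard deviation sigma is -x^2 / (2
    sigma^2), so sigma^2 must be \<alpha> / 2.\<close>
  have i: "integrable lborel (\<lambda>x. sqrt (2 * pi * (sqrt (\<alpha>/2))\<^sup>2) * normal_density 0 (sqrt (\<alpha>/2)) x)"
    using assms by (intro integrable_mult_right integrable_normal_density) auto
  have "(\<lambda>x. sqrt (2 * pi * (sqrt (\<alpha>/2))\<^sup>2) * normal_density 0 (sqrt (\<alpha>/2)) x) = (\<lambda>x. exp (- x\<^sup>2 / \<alpha>))"
    using assms by (simp add: normal_density_def fun_eq_iff)
  with i have i: "integrable lborel (\<lambda>x. exp (- x\<^sup>2 / \<alpha>) :: real)"
    by simp
  have fin: "(\<integral>\<^sup>+x. ennreal (exp (- x\<^sup>2 / \<alpha>)) \<partial>lborel) < \<infinity>"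
    using i by (simp add: integrable_iff_bounded)
  have "(\<integral>\<^sup>+v. ennreal (norm (gauss \<alpha> (v::'a))) \<partial>lborel)
      = (\<integral>\<^sup>+v. (\<Prod>b\<in>Basis. ennreal (?f b ((v::'a) \<bullet> b))) \<partial>lborel)"
    by (intro nn_integral_cong) (simp add: 1 prod_ennreal prod_nonneg)
  also have "\<dots> = (\<Prod>b\<in>(Basis::'a set). \<integral>\<^sup>+x. ennreal (?f b x) \<partial>lborel)"
    by (rule nn_integral_lborel_prod) auto
  also have "\<dots> < \<infinity>"
    using fin by (simp add: ennreal_prod_eq_top less_top[symmetric] power_eq_top_ennreal)
  finally show "(\<integral>\<^sup>+v. ennreal (norm (gauss \<alpha> (v::'a))) \<partial>lborel) < \<infinity>" .
qed measurable

text \<open>The classical value is (pi \<alpha>) to the power DIM / 2. Carrying the symbol leaves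
  only its positivity to be proved.\<close>

definition gauss_total :: "'a::euclidean_space itself \<Rightarrow> real \<Rightarrow> real" where
  "gauss_total _ \<alpha> = (LINT v|lborel. gauss \<alpha> (v::'a))"

lemma gauss_total_pos:
  assumes "\<alpha> > 0"
  shows "gauss_total TYPE('a::euclidean_space) \<alpha> > 0"
proof -
  have "gauss_total TYPE('a) \<alpha> \<ge> 0"
    unfolding gauss_total_def by (rule Bochner_Integration.integral_nonneg) simp
  moreover have "gauss_total TYPE('a) \<alpha> \<noteq> 0"
  proof
    assume "gauss_total TYPE('a) \<alpha> = 0"
    then have "AE v in lborel. gauss \<alpha> (v::'a) = 0"
      unfolding gauss_total_def
      using integral_nonneg_eq_0_iff_AE[OF integrable_gauss[OF assms, where 'a = 'a]] by simp
    then have "AE v in (lborel::'a measure). False"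
      by eventually_elim (simp add: gauss_def)
    then show False by (simp add: eventually_False ae_filter_eq_bot_iff)
  qed
  ultimately show ?thesis by simp
qed

lemma lborel_integral_translate:
  fixes f :: "'a::euclidean_space \<Rightarrow> 'b::{banach, second_countable_topology}"
  assumes [measurable]: "f \<in> borel_measurable borel"
  shows "(LINT v|lborel. f (c + v)) = (LINT v|lborel. f v)"
proof -
  have "(LINT v|lborel. f v) = (LINT v|distr lborel borel ((+) c). f v)"
    by (simp only: lborel_distr_plus)
  also have "\<dots> = (LINT v|lborel. f (c + v))"
    by (subst integral_distr) auto
  finally show ?thesis by simp
qed

lemma lborel_nn_integral_translate:
  fixes f :: "'a::euclidean_space \<Rightarrow> ennreal"
  assumes [measurable]: "f \<in> borel_measurable borel"
  shows "(\<integral>\<^sup>+v. f (c + v) \<partial>lborel) = (\<integral>\<^sup>+v. f v \<partial>lborel)"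
proof -
  have "(\<integral>\<^sup>+v. f v \<partial>lborel) = (\<integral>\<^sup>+v. f v \<partial>distr lborel borel ((+) c))"
    by (simp only: lborel_distr_plus)
  also have "\<dots> = (\<integral>\<^sup>+v. f (c + v) \<partial>lborel)"
    by (subst nn_integral_distr) auto
  finally show ?thesis by simp
qed

lemma lborel_integrable_translate:
  fixes f :: "'a::euclidean_space \<Rightarrow> 'b::{banach, second_countable_topology}"
  assumes "integrable lborel f"
  shows "integrable lborel (\<lambda>v. f (c + v))"
proof -
  have "integrable (distr lborel borel ((+) c)) f"
    using assms by (simp only: lborel_distr_plus)
  then show ?thesis
    by (subst (asm) integrable_distr_eq) (use assms in auto)
qed

text \<open>Completing the square turns the exponential factor into a translation of the weight by u
  / 2, so integrability and the value of the integral both follow from translation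
  invariance.\<close>

lemma gauss_mult_exp_inner:
  assumes "\<alpha> > 0"
  shows "exp (v \<bullet> u / \<alpha>) * gauss \<alpha> v = exp ((norm u)\<^sup>2 / (4 * \<alpha>)) * gauss \<alpha> (- (u /\<^sub>R 2) + v)"
proof -
  have "v \<bullet> u / \<alpha> - (norm v)\<^sup>2 / \<alpha> = (norm u)\<^sup>2 / (4 * \<alpha>) - (norm (- (u /\<^sub>R 2) + v))\<^sup>2 / \<alpha>"
    using assms
    by (simp add: power2_norm_eq_inner inner_simps field_simps inner_commute)
  then show ?thesis
    by (simp add: gauss_def exp_add[symmetric])
qed

lemma integrable_exp_inner_gauss:
  fixes u :: "'a::euclidean_space"
  assumes "\<alpha> > 0"
  shows "integrable lborel (\<lambda>v. exp (v \<bullet> u / \<alpha>) * gauss \<alpha> v)"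
  unfolding gauss_mult_exp_inner[OF assms]
  by (intro integrable_mult_right lborel_integrable_translate integrable_gauss assms)

lemma integral_exp_inner_gauss:
  fixes u :: "'a::euclidean_space"
  assumes "\<alpha> > 0"
  shows "(LINT v|lborel. exp (v \<bullet> u / \<alpha>) * gauss \<alpha> v)
       = exp ((norm u)\<^sup>2 / (4 * \<alpha>)) * gauss_total TYPE('a) \<alpha>"
  unfolding gauss_mult_exp_inner[OF assms]
  by (subst integral_mult_right_zero, subst lborel_integral_translate) (auto simp: gauss_total_def)

section \<open>Invariance of Lebesgue measure under linear isometries\<close>

text \<open>The integral of \<open>F (f x) * indicator (ball 0 1) (y - f x)\<close> over all \<open>x\<close> and \<open>y\<close>, computed in
  both orders.\<close>

lemma nn_integral_lborel_linear_isometry: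
  fixes f g :: "'a::euclidean_space \<Rightarrow> 'a"
  assumes f: "linear f" "\<And>x. norm (f x) = norm x" "\<And>x. f (g x) = x"
    and F [measurable]: "F \<in> borel_measurable borel"
  shows "(\<integral>\<^sup>+x. F (f x) \<partial>lborel) = (\<integral>\<^sup>+x. F x \<partial>lborel)"
proof -
  define \<beta> where "\<beta> = emeasure lborel (ball (0::'a) 1)"
  let ?B = "\<lambda>x. indicator (ball (0::'a) 1) x :: ennreal"
  have [measurable]: "f \<in> borel_measurable borel"
    by (intro borel_measurable_continuous_onI linear_continuous_on linear_linear[THEN iffD2] f(1))
  have [measurable]: "ball (0::'a) 1 \<in> sets borel"
    by simp
  have translate: "(\<integral>\<^sup>+x. G (f x + y) \<partial>lborel) = (\<integral>\<^sup>+x. G (f x) \<partial>lborel)"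
    if [measurable]: "G \<in> borel_measurable borel" for G :: "'a \<Rightarrow> ennreal" and y
  proof -
    \<comment> \<open>As \<open>y = f (g y)\<close>, a translation after \<open>f\<close> is a
      translation before it.\<close>
    have "(\<integral>\<^sup>+x. G (f x + y) \<partial>lborel) = (\<integral>\<^sup>+x. G (f (g y + x)) \<partial>lborel)"
      by (simp add: linear_add[OF f(1)] f(3) add.commute)
    also have "\<dots> = (\<integral>\<^sup>+x. G (f x) \<partial>lborel)"
      by (rule lborel_nn_integral_translate) measurable
    finally show ?thesis .
  qed
  have "(\<integral>\<^sup>+x. \<integral>\<^sup>+y. F (f x) * ?B (y - f x) \<partial>lborel \<partial>lborel) = (\<integral>\<^sup>+x. F (f x) * \<beta> \<partial>lborel)"
  proof (rule nn_integral_cong)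
    fix x
    have "(\<integral>\<^sup>+y. ?B (- f x + y) \<partial>lborel) = \<beta>"
      unfolding \<beta>_def by (subst lborel_nn_integral_translate) (auto intro!: borel_measurable_indicator)
    moreover have "(\<integral>\<^sup>+y. F (f x) * ?B (- f x + y) \<partial>lborel) = F (f x) * (\<integral>\<^sup>+y. ?B (- f x + y) \<partial>lborel)"
      by (rule nn_integral_cmult) measurable
    ultimately show "(\<integral>\<^sup>+y. F (f x) * ?B (y - f x) \<partial>lborel) = F (f x) * \<beta>"
      by simp
  qed
  moreover have "(\<integral>\<^sup>+x. \<integral>\<^sup>+y. F (f x) * ?B (y - f x) \<partial>lborel \<partial>lborel)
      = (\<integral>\<^sup>+y. \<integral>\<^sup>+x. F (f x) * ?B (y - f x) \<partial>lborel \<partial>lborel)"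
    by (rule lborel_pair.Fubini') measurable
  moreover have "\<dots> = (\<integral>\<^sup>+y. \<integral>\<^sup>+x. F (f x + y) * ?B (- f x) \<partial>lborel \<partial>lborel)"
  proof (rule nn_integral_cong)
    fix y
    show "(\<integral>\<^sup>+x. F (f x) * ?B (y - f x) \<partial>lborel) = (\<integral>\<^sup>+x. F (f x + y) * ?B (- f x) \<partial>lborel)"
      using translate[of "\<lambda>x. F x * ?B (y - x)" y] by simp
  qed
  moreover have "\<dots> = (\<integral>\<^sup>+x. \<integral>\<^sup>+y. F (f x + y) * ?B (- f x) \<partial>lborel \<partial>lborel)"
    by (rule lborel_pair.Fubini') measurable
  moreover have "\<dots> = (\<integral>\<^sup>+x. (\<integral>\<^sup>+y. F y \<partial>lborel) * ?B x \<partial>lborel)"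
  proof (rule nn_integral_cong)
    fix x
    have "?B (- f x) = ?B x"
      by (simp add: indicator_def f(2))
    then show "(\<integral>\<^sup>+y. F (f x + y) * ?B (- f x) \<partial>lborel) = (\<integral>\<^sup>+y. F y \<partial>lborel) * ?B x"
      by (subst nn_integral_multc) (auto simp: lborel_nn_integral_translate)
  qed
  moreover have "\<dots> = (\<integral>\<^sup>+y. F y \<partial>lborel) * \<beta>"
    by (subst nn_integral_cmult) (auto simp: \<beta>_def)
  ultimately have "(\<integral>\<^sup>+x. F (f x) \<partial>lborel) * \<beta> = (\<integral>\<^sup>+x. F x \<partial>lborel) * \<beta>"
    by (simp add: nn_integral_multc)
  moreover have "\<beta> \<noteq> \<infinity>" "\<beta> \<noteq> 0"
    using emeasure_lborel_ball_finite[of "0::'a" 1] content_ball_pos[of 1 "0::'a"]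
    by (auto simp: \<beta>_def measure_def)
  ultimately show ?thesis
    by (simp add: mult.commute[of _ \<beta>] ennreal_mult_cancel_left)
qed

lemma lborel_integral_linear_isometry:
  fixes f g :: "'a::euclidean_space \<Rightarrow> 'a"
    and F :: "'a \<Rightarrow> 'b::{banach, second_countable_topology}"
  assumes f: "linear f" "\<And>x. norm (f x) = norm x" "\<And>x. f (g x) = x"
    and F [measurable]: "F \<in> borel_measurable borel"
  shows "(LINT x|lborel. F (f x)) = (LINT x|lborel. F x)"
proof -
  have [measurable]: "f \<in> borel_measurable borel"
    by (intro borel_measurable_continuous_onI linear_continuous_on linear_linear[THEN iffD2] f(1))
  have "distr lborel lborel f = (lborel :: 'a measure)"
  proof (rule measure_eqI)
    fix A :: "'a set" assume "A \<in> sets (distr lborel lborel f)"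
    then have [measurable]: "A \<in> sets borel" by simp
    have "emeasure (distr lborel lborel f) A = (\<integral>\<^sup>+x. indicator A (f x) \<partial>lborel)"
      by (subst nn_integral_indicator[symmetric], simp, subst nn_integral_distr)
         (auto intro!: borel_measurable_indicator)
    also have "\<dots> = emeasure lborel A"
      by (subst nn_integral_lborel_linear_isometry[OF f]) auto
    finally show "emeasure (distr lborel lborel f) A = emeasure lborel A" .
  qed simp
  then have "(LINT x|lborel. F x) = (LINT x|distr lborel lborel f. F x)"
    by simp
  also have "\<dots> = (LINT x|lborel. F (f x))"
    by (rule integral_distr) auto
  finally show ?thesis by simp
qed

section \<open>Circle averages of exponentials\<close>

text \<open>Bounded support keeps linear forms bounded where the weight lives, so exponential series
  may be integrated term by term. Rotations here are multiplications by unimodular scalars.\<close>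

locale rotation_invariant_weight =
  fixes \<rho> :: "complex^'n::finite \<Rightarrow> real"
  assumes weight_nonneg: "\<rho> v \<ge> 0"
    and weight_integrable: "integrable lborel \<rho>"
    and weight_rotate: "\<And>c v. norm c = 1 \<Longrightarrow> \<rho> (c *s v) = \<rho> v"
    and weight_bounded_support: "\<exists>R. \<forall>v. \<rho> v \<noteq> 0 \<longrightarrow> norm v \<le> R"
begin

lemma weight_measurable [measurable]: "\<rho> \<in> borel_measurable borel"
  using weight_integrable by (simp add: borel_measurable_integrable)

lemma integral_rotate:
  fixes F :: "complex^'n \<Rightarrow> complex"
  assumes "norm c = 1" and [measurable]: "F \<in> borel_measurable borel"
  shows "(LINT v|lborel. F (c *s v)) = (LINT v|lborel. F v)"
proof (rule lborel_integral_linear_isometry[where g = "\<lambda>v. cnj c *s v"])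
  show "linear (\<lambda>v. c *s v)"
    by (rule linearI) (simp_all add: vec_eq_iff algebra_simps)
  have "c * cnj c = 1"
    using assms(1) by (simp add: complex_norm_square[symmetric])
  then show "c *s (cnj c *s v) = v" for v :: "complex^'n"
    by (simp add: vector_smult_assoc)
qed (use assms in \<open>simp_all add: norm_smult_vec\<close>)

lemma integrable_weight_bounded:
  fixes F :: "complex^'n \<Rightarrow> complex"
  assumes [measurable]: "F \<in> borel_measurable borel"
    and "\<And>v. \<rho> v \<noteq> 0 \<Longrightarrow> norm (F v) \<le> C"
  shows "integrable lborel (\<lambda>v. of_real (\<rho> v) * F v)"
proof (rule Bochner_Integration.integrable_bound)
  show "integrable lborel (\<lambda>v. C * \<rho> v)"
    using weight_integrable by simp
  have "norm (of_real (\<rho> v) * F v) \<le> norm (C * \<rho> v)" for v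
    using assms(2)[of v] weight_nonneg[of v]
    by (cases "\<rho> v = 0") (auto simp: norm_mult abs_mult mult.commute intro!: mult_right_mono)
  then show "AE v in lborel. norm (of_real (\<rho> v) * F v) \<le> norm (C * \<rho> v)"
    by simp
qed measurable

text \<open>A rotation by the angle t multiplies the integrand by cis ((j - m) t). The angle is
  chosen with (j - m) t = pi, so a single rotation already shows that the integral equals its own
  negative.\<close>

lemma integral_monomial_zero:
  assumes [measurable]: "a \<in> borel_measurable borel" "b \<in> borel_measurable borel"
    and a: "\<And>c v. norm c = 1 \<Longrightarrow> a (c *s v) = c * a v"
    and b: "\<And>c v. norm c = 1 \<Longrightarrow> b (c *s v) = cnj c * b v"
    and "j \<noteq> m"
  shows "(LINT v|lborel. of_real (\<rho> v) * (a v ^ j * b v ^ m)) = 0"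
proof -
  define t where "t = pi / (real j - real m)"
  let ?F = "\<lambda>v. of_real (\<rho> v) * (a v ^ j * b v ^ m)"
  have "cis t ^ j * cnj (cis t) ^ m = cis ((real j - real m) * t)"
    by (simp only: cis_cnj Complex.DeMoivre cis_mult) (simp add: algebra_simps)
  also have "\<dots> = - 1"
    using \<open>j \<noteq> m\<close> by (simp add: t_def)
  finally have eq: "cis t ^ j * cnj (cis t) ^ m = - 1" .
  have "?F (cis t *s v) = (cis t ^ j * cnj (cis t) ^ m) * ?F v" for v
    by (simp add: a b weight_rotate power_mult_distrib mult_ac)
  then have "?F (cis t *s v) = - ?F v" for v
    unfolding eq by simp
  moreover have "(LINT v|lborel. ?F (cis t *s v)) = (LINT v|lborel. ?F v)"
    by (rule integral_rotate) auto
  ultimately have "- (LINT v|lborel. ?F v) = (LINT v|lborel. ?F v)"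
    by simp
  then show ?thesis by simp
qed

text \<open>On the support the k-th term is at most \<open>\<rho> v * (C ^ k / fact k)\<close>, so
  the integrals of the norms are summable.\<close>

lemma integral_exp_sums:
  fixes h :: "complex^'n \<Rightarrow> complex"
  assumes [measurable]: "h \<in> borel_measurable borel"
    and C: "\<And>v. \<rho> v \<noteq> 0 \<Longrightarrow> norm (h v) \<le> C"
  shows "(\<lambda>k. LINT v|lborel. of_real (\<rho> v) * (h v ^ k /\<^sub>R fact k)) sums
           (LINT v|lborel. of_real (\<rho> v) * exp (h v))"
proof -
  let ?f = "\<lambda>k v. of_real (\<rho> v) * (h v ^ k /\<^sub>R fact k)"
  have bound: "norm (?f k v) \<le> \<rho> v * (C ^ k / fact k)" for k v
    using C[of v] weight_nonneg[of v]
    by (cases "\<rho> v = 0")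
       (auto simp: norm_mult norm_power divide_inverse mult.commute intro!: mult_left_mono power_mono)
  have summ: "summable (\<lambda>k. C ^ k / fact k)"
    using summable_exp[of C] by (simp add: divide_inverse mult.commute)
  have int: "integrable lborel (?f k)" for k
  proof (rule integrable_weight_bounded)
    show "norm (h v ^ k /\<^sub>R fact k) \<le> C ^ k / fact k" if "\<rho> v \<noteq> 0" for v
      using C[OF that] by (auto simp: norm_power divide_inverse mult.commute intro!: mult_left_mono power_mono)
  qed measurable
  have "(\<lambda>k. LINT v|lborel. ?f k v) sums (LINT v|lborel. (\<Sum>k. ?f k v))"
  proof (rule sums_integral[OF int])
    show "AE v in lborel. summable (\<lambda>k. norm (?f k v))"
    proof (intro AE_I2)
      fix v
      show "summable (\<lambda>k. norm (?f k v))"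
        by (rule summable_comparison_test[OF _ summable_mult[OF summ, of "\<rho> v"]])
           (use bound in auto)
    qed
    have "(LINT v|lborel. norm (?f k v)) \<le> (LINT v|lborel. \<rho> v * (C ^ k / fact k))" for k
      by (intro integral_mono integrable_norm int integrable_mult_left weight_integrable bound)
    then have le: "(LINT v|lborel. norm (?f k v)) \<le> (LINT v|lborel. \<rho> v) * (C ^ k / fact k)" for k
      by simp
    show "summable (\<lambda>k. LINT v|lborel. norm (?f k v))"
      by (rule summable_comparison_test[OF _ summable_mult[OF summ, of "LINT v|lborel. \<rho> v"]])
         (use le in auto)
  qed
  moreover have "(\<Sum>k. ?f k v) = of_real (\<rho> v) * exp (h v)" for v
    unfolding exp_def by (rule suminf_mult) (rule summable_exp_generic)
  ultimately show ?thesis by simp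
qed

text \<open>By invariance only the terms of the exponential series with equally many factors \<open>a\<close> and
  \<open>b\<close> contribute, so the integral depends on the product of \<open>a\<close> and \<open>b\<close> only.\<close>

lemma integral_exp_eq:
  assumes meas [measurable]: "a \<in> borel_measurable borel" "b \<in> borel_measurable borel"
      "a' \<in> borel_measurable borel" "b' \<in> borel_measurable borel"
    and a: "\<And>c v. norm c = 1 \<Longrightarrow> a (c *s v) = c * a v"
    and b: "\<And>c v. norm c = 1 \<Longrightarrow> b (c *s v) = cnj c * b v"
    and a': "\<And>c v. norm c = 1 \<Longrightarrow> a' (c *s v) = c * a' v"
    and b': "\<And>c v. norm c = 1 \<Longrightarrow> b' (c *s v) = cnj c * b' v"
    and bound: "\<And>v. norm (a v) \<le> C * norm v" "\<And>v. norm (b v) \<le> C * norm v"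
      "\<And>v. norm (a' v) \<le> C * norm v" "\<And>v. norm (b' v) \<le> C * norm v"
    and prod: "\<And>v. a v * b v = a' v * b' v"
  shows "(LINT v|lborel. of_real (\<rho> v) * exp (a v + b v)) =
         (LINT v|lborel. of_real (\<rho> v) * exp (a' v + b' v))"
proof -
  obtain R where R: "\<And>v. \<rho> v \<noteq> 0 \<Longrightarrow> norm v \<le> R"
    using weight_bounded_support by auto
  define D where "D = \<bar>C\<bar> * \<bar>R\<bar>"
  have le_D: "C * norm v \<le> D" if "\<rho> v \<noteq> 0" for v
    using R[OF that] unfolding D_def
    by (meson abs_ge_self abs_ge_zero mult_mono norm_ge_zero order_trans)
  have D: "norm (a v) \<le> D" "norm (b v) \<le> D" "norm (a' v) \<le> D" "norm (b' v) \<le> D"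
    if "\<rho> v \<noteq> 0" for v
    using bound[of v] le_D[OF that] by linarith+
  have binom: "(LINT v|lborel. of_real (\<rho> v) * ((x v + y v) ^ k /\<^sub>R fact k)) =
      (\<Sum>j\<le>k. (LINT v|lborel. of_real (\<rho> v) * (x v ^ j * y v ^ (k - j))) * of_nat (k choose j) / fact k)"
    if [measurable]: "x \<in> borel_measurable borel" "y \<in> borel_measurable borel"
      and xy: "\<And>v. \<rho> v \<noteq> 0 \<Longrightarrow> norm (x v) \<le> D" "\<And>v. \<rho> v \<noteq> 0 \<Longrightarrow> norm (y v) \<le> D"
    for x y :: "complex^'n \<Rightarrow> complex" and k
  proof -
    have "integrable lborel (\<lambda>v. of_real (\<rho> v) * (x v ^ j * y v ^ m))" for j m
    proof (rule integrable_weight_bounded)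
      show "norm (x v ^ j * y v ^ m) \<le> D ^ j * D ^ m" if "\<rho> v \<noteq> 0" for v
        unfolding norm_mult norm_power using xy[OF that]
        by (intro mult_mono power_mono) (auto intro: order_trans[OF norm_ge_zero] zero_le_power)
    qed measurable
    note int = this
    have "of_real (\<rho> v) * ((x v + y v) ^ k /\<^sub>R fact k) =
        (\<Sum>j\<le>k. of_real (\<rho> v) * (x v ^ j * y v ^ (k - j)) * of_nat (k choose j) / fact k)" for v
      by (simp add: binomial_ring sum_distrib_left scaleR_conv_of_real divide_inverse
          sum_distrib_right mult_ac)
    then show ?thesis
      using int by simp
  qed
  have "(LINT v|lborel. of_real (\<rho> v) * (a v ^ j * b v ^ m)) =
        (LINT v|lborel. of_real (\<rho> v) * (a' v ^ j * b' v ^ m))" for j m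
  proof (cases "j = m")
    case True
    then show ?thesis
      by (simp add: power_mult_distrib[symmetric] prod)
  next
    case False
    then show ?thesis
      using integral_monomial_zero[of a b j m] integral_monomial_zero[of a' b' j m] a b a' b' by simp
  qed
  then have eq: "(LINT v|lborel. of_real (\<rho> v) * ((a v + b v) ^ k /\<^sub>R fact k)) =
      (LINT v|lborel. of_real (\<rho> v) * ((a' v + b' v) ^ k /\<^sub>R fact k))" for k
    using binom[of a b k] binom[of a' b' k] D by simp
  have "(\<lambda>k. LINT v|lborel. of_real (\<rho> v) * ((x v + y v) ^ k /\<^sub>R fact k)) sums
           (LINT v|lborel. of_real (\<rho> v) * exp (x v + y v))"
    if [measurable]: "x \<in> borel_measurable borel" "y \<in> borel_measurable borel"
      and xy: "\<And>v. \<rho> v \<noteq> 0 \<Longrightarrow> norm (x v) \<le> D" "\<And>v. \<rho> v \<noteq> 0 \<Longrightarrow> norm (y v) \<le> D"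
    for x y :: "complex^'n \<Rightarrow> complex"
  proof (rule integral_exp_sums)
    show "norm (x v + y v) \<le> D + D" if "\<rho> v \<noteq> 0" for v
      using norm_triangle_mono[OF xy(1)[OF that] xy(2)[OF that]] .
  qed measurable
  note sums = this
  show ?thesis
    using sums[OF meas(1,2) D(1,2)] sums[OF meas(3,4) D(3,4)] unfolding eq
    by (rule sums_unique2)
qed

end

section \<open>Gaussian weights cut off to balls\<close>

definition trunc_gauss :: "real \<Rightarrow> real \<Rightarrow> 'a::euclidean_space \<Rightarrow> real" where
  "trunc_gauss \<alpha> R v = indicator (ball 0 R) v * gauss \<alpha> v"

lemma trunc_gauss_nonneg [simp]: "trunc_gauss \<alpha> R v \<ge> 0"
  and trunc_gauss_le: "trunc_gauss \<alpha> R v \<le> gauss \<alpha> v"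
  by (auto simp: trunc_gauss_def indicator_def)

lemma trunc_gauss_measurable [measurable]:
  assumes [measurable]: "f \<in> borel_measurable M"
  shows "(\<lambda>x. trunc_gauss \<alpha> R (f x)) \<in> borel_measurable M"
proof -
  have [measurable]: "ball (0::'b) R \<in> sets borel" by simp
  show ?thesis unfolding trunc_gauss_def by measurable
qed

lemma trunc_gauss_tendsto: "(\<lambda>N. trunc_gauss \<alpha> (real N) v) \<longlonglongrightarrow> gauss \<alpha> v"
proof (rule tendsto_eventually)
  obtain N where "norm v < real N"
    using reals_Archimedean2 by blast
  then show "\<forall>\<^sub>F N in sequentially. trunc_gauss \<alpha> (real N) v = gauss \<alpha> v"
    by (intro eventually_sequentiallyI[of N]) (auto simp: trunc_gauss_def indicator_def)
qed

lemma integrable_trunc_gauss: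
  assumes "\<alpha> > 0"
  shows "integrable lborel (trunc_gauss \<alpha> R :: 'a::euclidean_space \<Rightarrow> real)"
proof (rule Bochner_Integration.integrable_bound)
  show "integrable lborel (gauss \<alpha> :: 'a \<Rightarrow> real)"
    by (rule integrable_gauss[OF assms])
qed (auto simp: trunc_gauss_le)

lemma rotation_invariant_trunc_gauss:
  assumes "\<alpha> > 0"
  shows "rotation_invariant_weight (trunc_gauss \<alpha> R :: complex^'n::finite \<Rightarrow> real)"
proof
  show "\<exists>R'. \<forall>v. (trunc_gauss \<alpha> R :: complex^'n \<Rightarrow> real) v \<noteq> 0 \<longrightarrow> norm v \<le> R'"
    by (rule exI[of _ R]) (auto simp: trunc_gauss_def indicator_def)
qed (simp_all add: integrable_trunc_gauss assms trunc_gauss_def gauss_def indicator_def norm_smult_vec)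

section \<open>The reproducing property on kernels\<close>

text \<open>A holomorphic exponential in \<open>v\<close> with parameter \<open>w\<close> times an
  antiholomorphic one with parameter \<open>z\<close>. Setting one parameter to 0 leaves a purely
  (anti)holomorphic function, called degenerate below.\<close>

definition mixed_exp :: "real \<Rightarrow> complex^'n::finite \<Rightarrow> complex^'n \<Rightarrow> complex^'n \<Rightarrow> complex" where
  "mixed_exp \<alpha> w z v = exp ((herm v w + herm z v) / of_real \<alpha>)"

lemma mixed_exp_measurable [measurable]: "mixed_exp \<alpha> w z \<in> borel_measurable borel"
  unfolding mixed_exp_def[abs_def] by measurable

lemma norm_mixed_exp: "norm (mixed_exp \<alpha> w z v) = exp (v \<bullet> (w + z) / \<alpha>)"
proof -
  have "Re ((herm v w + herm z v) / of_real \<alpha>) = v \<bullet> (w + z) / \<alpha>"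
    by (simp add: Re_herm inner_add_right inner_commute)
  then show ?thesis
    by (simp add: mixed_exp_def)
qed

lemma integrable_mixed_exp_gauss:
  assumes "\<alpha> > 0"
  shows "integrable lborel (\<lambda>v. of_real (gauss \<alpha> v) * mixed_exp \<alpha> w z v)"
proof (rule Bochner_Integration.integrable_bound)
  show "integrable lborel (\<lambda>v. exp (v \<bullet> (w + z) / \<alpha>) * gauss \<alpha> v)"
    by (rule integrable_exp_inner_gauss[OF assms])
qed (simp_all add: norm_mult norm_mixed_exp mult.commute)

text \<open>Two exponentials of the same type merge into a degenerate one with parameter
  \<open>w + z\<close>, so only the first two of the nine terms are genuinely mixed.\<close>

lemma K_ph_mult_K_ph:
  "K_ph \<alpha> v w * K_ph \<alpha> v z =
     mixed_exp \<alpha> w z v + mixed_exp \<alpha> z w v + mixed_exp \<alpha> (w + z) 0 v + mixed_exp \<alpha> 0 (w + z) v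
     - mixed_exp \<alpha> w 0 v - mixed_exp \<alpha> 0 w v - mixed_exp \<alpha> z 0 v - mixed_exp \<alpha> 0 z v
     + mixed_exp \<alpha> 0 0 v"
  by (simp add: K_ph_def mixed_exp_def herm_add_left herm_add_right add_divide_distrib exp_add
      algebra_simps)

text \<open>The seven degenerate terms share the integral \<open>c\<close> and occur with total sign
  2 - 4 + 1 = -1. The weight is left general because the formula serves both the full and the
  cut-off Gaussian.\<close>

lemma integral_K_ph_mult:
  fixes \<rho> :: "complex^'n::finite \<Rightarrow> real"
  assumes int: "\<And>w z. integrable lborel (\<lambda>v. of_real (\<rho> v) * mixed_exp \<alpha> w z v)"
    and left: "\<And>w. (LINT v|lborel. of_real (\<rho> v) * mixed_exp \<alpha> w 0 v) = of_real c"
    and right: "\<And>z. (LINT v|lborel. of_real (\<rho> v) * mixed_exp \<alpha> 0 z v) = of_real c"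
  shows "integrable lborel (\<lambda>v. of_real (\<rho> v) * (K_ph \<alpha> v w * K_ph \<alpha> v z))"
    and "(LINT v|lborel. of_real (\<rho> v) * (K_ph \<alpha> v w * K_ph \<alpha> v z)) =
      (LINT v|lborel. of_real (\<rho> v) * mixed_exp \<alpha> w z v)
      + (LINT v|lborel. of_real (\<rho> v) * mixed_exp \<alpha> z w v) - of_real c"
  unfolding K_ph_mult_K_ph distrib_left right_diff_distrib
  by (intro Bochner_Integration.integrable_add Bochner_Integration.integrable_diff int)
     (simp add: int left right)

context
  fixes \<alpha> :: real
  assumes \<alpha>: "\<alpha> > 0"
begin

lemma integrable_mixed_exp_trunc:
  fixes w z :: "complex^'n::finite"
  shows "integrable lborel (\<lambda>v. of_real (trunc_gauss \<alpha> R v) * mixed_exp \<alpha> w z v)"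
proof (rule Bochner_Integration.integrable_bound)
  show "integrable lborel (\<lambda>v. of_real (gauss \<alpha> v) * mixed_exp \<alpha> w z v)"
    by (rule integrable_mixed_exp_gauss[OF \<alpha>])
qed (auto simp: norm_mult intro!: mult_right_mono trunc_gauss_le)

text \<open>The exponent is a term of rotation degree 1 plus a term of degree -1, and only their
  product matters. This allows both the rescaling of the parameters by reciprocal factors and the
  replacement of a parameter by 0 when the other one is 0.\<close>

lemma trunc_mixed_exp_eq:
  fixes w z w' z' :: "complex^'n::finite"
  assumes "\<And>v. herm v w * herm z v = herm v w' * herm z' v"
  shows "(LINT v|lborel. of_real (trunc_gauss \<alpha> R v) * mixed_exp \<alpha> w z v) =
         (LINT v|lborel. of_real (trunc_gauss \<alpha> R v) * mixed_exp \<alpha> w' z' v)"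
proof -
  define C where "C = (norm w + norm z + norm w' + norm z') / \<alpha>"
  have 1: "norm (herm v x / of_real \<alpha>) \<le> C * norm v" "norm (herm x v / of_real \<alpha>) \<le> C * norm v"
    if "x \<in> {w, z, w', z'}" for x v
  proof -
    have "norm x * norm v \<le> (norm w + norm z + norm w' + norm z') * norm v"
      using that by (intro mult_right_mono) auto
    then have "norm x * norm v / \<alpha> \<le> C * norm v"
      using \<alpha> by (simp add: C_def divide_right_mono)
    moreover have "norm (herm v x) / \<alpha> \<le> norm x * norm v / \<alpha>" "norm (herm x v) / \<alpha> \<le> norm x * norm v / \<alpha>"
      using \<alpha> norm_herm_le[of v x] norm_herm_le[of x v] by (auto simp: divide_right_mono mult.commute)
    ultimately show "norm (herm v x / of_real \<alpha>) \<le> C * norm v" "norm (herm x v / of_real \<alpha>) \<le> C * norm v"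
      using \<alpha> by (auto simp: norm_divide)
  qed
  show ?thesis
    unfolding mixed_exp_def add_divide_distrib
    by (rule rotation_invariant_weight.integral_exp_eq[OF rotation_invariant_trunc_gauss[OF \<alpha>],
        where C = C])
       (use 1 assms in \<open>auto simp: herm_smult_left herm_smult_right\<close>)
qed

text \<open>The mean value property for (anti)holomorphic exponentials: the product of the two
  linear forms vanishes, so both parameters can be replaced by 0.\<close>

lemma trunc_mixed_exp_degenerate:
  fixes w z :: "complex^'n::finite"
  shows "(LINT v|lborel. of_real (trunc_gauss \<alpha> R v) * mixed_exp \<alpha> w 0 v) =
           of_real (LINT v|lborel. trunc_gauss \<alpha> R (v :: complex^'n))"
    and "(LINT v|lborel. of_real (trunc_gauss \<alpha> R v) * mixed_exp \<alpha> 0 z v) =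
           of_real (LINT v|lborel. trunc_gauss \<alpha> R (v :: complex^'n))"
  by (simp_all add: trunc_mixed_exp_eq[of w 0 0 0] trunc_mixed_exp_eq[of 0 z 0 0]) (simp_all add: mixed_exp_def)

text \<open>Rescaling \<open>w\<close> and \<open>z\<close> to equal norms before estimating removes the loss from
  \<open>norm (w + z) ^ 2 / 4\<close> to \<open>norm w * norm z\<close>.\<close>

lemma norm_trunc_mixed_exp_le:
  fixes w z :: "complex^'n::finite"
  shows "norm (LINT v|lborel. of_real (trunc_gauss \<alpha> R v) * mixed_exp \<alpha> w z v)
       \<le> gauss_total TYPE(complex^'n) \<alpha> * exp (norm w * norm z / \<alpha>)"
proof -
  have bound: "norm (LINT v|lborel. of_real (trunc_gauss \<alpha> R v) * mixed_exp \<alpha> w z v)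
       \<le> gauss_total TYPE(complex^'n) \<alpha> * exp ((norm (w + z))\<^sup>2 / (4 * \<alpha>))" for w z :: "complex^'n"
  proof -
    have "norm (LINT v|lborel. of_real (trunc_gauss \<alpha> R v) * mixed_exp \<alpha> w z v)
        \<le> (LINT v|lborel. norm (of_real (trunc_gauss \<alpha> R v) * mixed_exp \<alpha> w z v))"
      by (rule integral_norm_bound)
    also have "\<dots> \<le> (LINT v|lborel. exp (v \<bullet> (w + z) / \<alpha>) * gauss \<alpha> v)"
      by (intro integral_mono integrable_norm integrable_mixed_exp_trunc integrable_exp_inner_gauss \<alpha>)
         (simp add: norm_mult norm_mixed_exp mult.commute trunc_gauss_le)
    also have "\<dots> = gauss_total TYPE(complex^'n) \<alpha> * exp ((norm (w + z))\<^sup>2 / (4 * \<alpha>))"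
      by (simp add: integral_exp_inner_gauss[OF \<alpha>])
    finally show ?thesis .
  qed
  show ?thesis
  proof (cases "w = 0 \<or> z = 0")
    case True
    then have "(LINT v|lborel. of_real (trunc_gauss \<alpha> R v) * mixed_exp \<alpha> w z v) =
         (LINT v|lborel. of_real (trunc_gauss \<alpha> R v) * mixed_exp \<alpha> (0 :: complex^'n) 0 v)"
      by (intro trunc_mixed_exp_eq) auto
    with bound[of 0 0] True show ?thesis by auto
  next
    case False
    define s where "s = sqrt (norm z / norm w)"
    define a where "a = sqrt (norm w * norm z)"
    have s: "s > 0" "s * norm w = a" "norm z / s = a"
      using False by (auto simp: s_def a_def real_sqrt_divide real_sqrt_mult field_simps)
    have "(LINT v|lborel. of_real (trunc_gauss \<alpha> R v) * mixed_exp \<alpha> w z v) =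
        (LINT v|lborel. of_real (trunc_gauss \<alpha> R v) * mixed_exp \<alpha> (s *\<^sub>R w) (inverse s *\<^sub>R z) v)"
      using s by (intro trunc_mixed_exp_eq) (simp add: herm_scaleR_left herm_scaleR_right)
    also have "norm \<dots> \<le> gauss_total TYPE(complex^'n) \<alpha> * exp ((norm (s *\<^sub>R w + inverse s *\<^sub>R z))\<^sup>2 / (4 * \<alpha>))"
      by (rule bound)
    also have "(norm (s *\<^sub>R w + inverse s *\<^sub>R z))\<^sup>2 \<le> (2 * a)\<^sup>2"
      using s norm_triangle_ineq[of "s *\<^sub>R w" "inverse s *\<^sub>R z"]
      by (intro power_mono) (auto simp: divide_inverse mult.commute)
    also have "(2 * a)\<^sup>2 = 4 * (norm w * norm z)"
      by (simp add: a_def power_mult_distrib)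
    finally show ?thesis
      using \<alpha> gauss_total_pos[OF \<alpha>, where 'a = "complex^'n"]
      by (simp add: divide_right_mono mult_left_mono)
  qed
qed

lemma trunc_integral_tendsto:
  fixes F :: "'a::euclidean_space \<Rightarrow> complex"
  assumes int: "integrable lborel (\<lambda>v. of_real (gauss \<alpha> v) * F v)"
    and [measurable]: "F \<in> borel_measurable borel"
  shows "(\<lambda>N. LINT v|lborel. of_real (trunc_gauss \<alpha> (real N) v) * F v)
      \<longlonglongrightarrow> (LINT v|lborel. of_real (gauss \<alpha> v) * F v)"
proof (rule integral_dominated_convergence)
  show "integrable lborel (\<lambda>v. norm (of_real (gauss \<alpha> v) * F v))"
    by (rule integrable_norm[OF int])
  show "AE v in lborel. (\<lambda>N. of_real (trunc_gauss \<alpha> (real N) v) * F v) \<longlonglongrightarrow> of_real (gauss \<alpha> v) * F v"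
    by (intro AE_I2 tendsto_mult tendsto_of_real tendsto_const trunc_gauss_tendsto)
qed (auto simp: norm_mult intro!: mult_right_mono trunc_gauss_le)

lemma integral_mixed_exp_degenerate:
  fixes w :: "complex^'n::finite"
  shows "(LINT v|lborel. of_real (gauss \<alpha> v) * mixed_exp \<alpha> w 0 v)
       = of_real (gauss_total TYPE(complex^'n) \<alpha>)"
proof (rule LIMSEQ_unique)
  show "(\<lambda>N. LINT v|lborel. of_real (trunc_gauss \<alpha> (real N) v) * mixed_exp \<alpha> w 0 v)
     \<longlonglongrightarrow> (LINT v|lborel. of_real (gauss \<alpha> v) * mixed_exp \<alpha> w 0 v)"
    by (rule trunc_integral_tendsto[OF integrable_mixed_exp_gauss[OF \<alpha>]]) measurable
  have "(\<lambda>N. LINT v|lborel. of_real (trunc_gauss \<alpha> (real N) (v :: complex^'n)) * (1::complex))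
     \<longlonglongrightarrow> (LINT v|lborel. of_real (gauss \<alpha> (v :: complex^'n)) * 1)"
    by (rule trunc_integral_tendsto) (use integrable_gauss[OF \<alpha>] in auto)
  then show "(\<lambda>N. LINT v|lborel. of_real (trunc_gauss \<alpha> (real N) v) * mixed_exp \<alpha> w 0 v)
     \<longlonglongrightarrow> of_real (gauss_total TYPE(complex^'n) \<alpha>)"
    by (simp add: trunc_mixed_exp_degenerate gauss_total_def)
qed

text \<open>Translation by \<open>z\<close> cancels the antiholomorphic part of the exponent:
  -|z+v|^2 + herm (z+v) w + herm z (z+v) equals herm z w - |v|^2 + herm v (w-z). What remains is a
  degenerate integral.\<close>

lemma integral_mixed_exp:
  fixes w z :: "complex^'n::finite"
  shows "(LINT v|lborel. of_real (gauss \<alpha> v) * mixed_exp \<alpha> w z v)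
       = of_real (gauss_total TYPE(complex^'n) \<alpha>) * exp (herm z w / of_real \<alpha>)"
proof -
  have eq: "of_real (gauss \<alpha> (z + v)) * mixed_exp \<alpha> w z (z + v) =
      exp (herm z w / of_real \<alpha>) * (of_real (gauss \<alpha> v) * mixed_exp \<alpha> (w - z) 0 v)" for v
  proof -
    have "of_real ((norm (z + v))\<^sup>2) = herm z z + herm z v + herm v z + herm v v"
      by (simp only: herm_self[symmetric]) (simp add: herm_add_left herm_add_right)
    moreover have "herm v (w - z) = herm v w - herm v z"
      using herm_add_right[of v "w - z" z] by simp
    ultimately have "- of_real ((norm (z + v))\<^sup>2) / of_real \<alpha>
          + (herm (z + v) w + herm z (z + v)) / of_real \<alpha>
        = herm z w / of_real \<alpha> + (- of_real ((norm v)\<^sup>2) / of_real \<alpha> + herm v (w - z) / of_real \<alpha>)"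
      by (simp only: herm_self[symmetric] herm_add_left herm_add_right)
         (simp add: add_divide_distrib diff_divide_distrib)
    moreover have "of_real (gauss \<alpha> x) = exp (- of_real ((norm x)\<^sup>2) / of_real \<alpha> :: complex)"
      for x :: "complex^'n"
      unfolding gauss_def by (simp only: of_real_exp of_real_divide of_real_minus)
    ultimately show ?thesis
      by (simp only: mixed_exp_def exp_add[symmetric] herm_zero_left add_0_right)
  qed
  have "(LINT v|lborel. of_real (gauss \<alpha> v) * mixed_exp \<alpha> w z v) =
      (LINT v|lborel. of_real (gauss \<alpha> (z + v)) * mixed_exp \<alpha> w z (z + v))"
    by (rule lborel_integral_translate[symmetric]) measurable
  also have "\<dots> = exp (herm z w / of_real \<alpha>) * of_real (gauss_total TYPE(complex^'n) \<alpha>)"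
    unfolding eq by (simp add: integral_mixed_exp_degenerate)
  finally show ?thesis by simp
qed

lemma integrable_K_ph_mult:
  fixes w z :: "complex^'n::finite"
  shows "integrable lborel (\<lambda>v. of_real (gauss \<alpha> v) * (K_ph \<alpha> v w * K_ph \<alpha> v z))"
  by (rule integral_K_ph_mult[OF integrable_mixed_exp_gauss[OF \<alpha>]])
     (simp_all add: integral_mixed_exp)

lemma integral_K_ph_mult_gauss:
  fixes w z :: "complex^'n::finite"
  shows "(LINT v|lborel. of_real (gauss \<alpha> v) * (K_ph \<alpha> v w * K_ph \<alpha> v z))
       = of_real (gauss_total TYPE(complex^'n) \<alpha>) * K_ph \<alpha> w z"
  by (subst integral_K_ph_mult(2)[OF integrable_mixed_exp_gauss[OF \<alpha>],
        where c = "gauss_total TYPE(complex^'n) \<alpha>"])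
     (simp_all add: integral_mixed_exp K_ph_def algebra_simps)

text \<open>The bound does not depend on \<open>R\<close> and its exponent is linear in
  \<open>norm w\<close>, so it can serve as a dominating function against \<mu>. The factor 3 counts
  the two mixed terms and the constant one.\<close>

lemma norm_trunc_K_ph_mult_le:
  fixes w z :: "complex^'n::finite"
  shows "norm (LINT v|lborel. of_real (trunc_gauss \<alpha> R v) * (K_ph \<alpha> v w * K_ph \<alpha> v z))
       \<le> 3 * gauss_total TYPE(complex^'n) \<alpha> * exp (norm w * norm z / \<alpha>)"
proof -
  let ?N = "LINT v|lborel. trunc_gauss \<alpha> R (v :: complex^'n)"
  let ?G = "gauss_total TYPE(complex^'n) \<alpha> * exp (norm w * norm z / \<alpha>)"
  note K = integral_K_ph_mult[where \<rho> = "trunc_gauss \<alpha> R", OF integrable_mixed_exp_trunc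
      trunc_mixed_exp_degenerate, of w z]
  have "0 \<le> ?N"
    by (rule Bochner_Integration.integral_nonneg) simp
  moreover have "?N \<le> gauss_total TYPE(complex^'n) \<alpha>"
    unfolding gauss_total_def
    by (intro integral_mono integrable_trunc_gauss integrable_gauss \<alpha> trunc_gauss_le)
  moreover have "gauss_total TYPE(complex^'n) \<alpha> * 1 \<le> ?G"
    using gauss_total_pos[OF \<alpha>, where 'a = "complex^'n"] \<alpha> by (intro mult_left_mono) auto
  ultimately have N: "norm (of_real ?N :: complex) \<le> ?G" by simp
  have triangle: "norm (a + b - c) \<le> 3 * g" if "norm a \<le> g" "norm b \<le> g" "norm c \<le> g"
    for a b c :: complex and g
    using norm_triangle_ineq4[of "a + b" c] norm_triangle_ineq[of a b] that by linarith
  have "norm (LINT v|lborel. of_real (trunc_gauss \<alpha> R v) * (K_ph \<alpha> v w * K_ph \<alpha> v z)) \<le> 3 * ?G"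
    unfolding K(2)
  proof (rule triangle)
    show "norm (LINT v|lborel. of_real (trunc_gauss \<alpha> R v) * mixed_exp \<alpha> z w v) \<le> ?G"
      using norm_trunc_mixed_exp_le[of R z w] by (simp only: mult.commute[of "norm z"])
  qed (rule norm_trunc_mixed_exp_le, rule N)
  then show "norm (LINT v|lborel. of_real (trunc_gauss \<alpha> R v) * (K_ph \<alpha> v w * K_ph \<alpha> v z))
       \<le> 3 * gauss_total TYPE(complex^'n) \<alpha> * exp (norm w * norm z / \<alpha>)"
    by (simp only: mult.assoc)
qed

end

section \<open>The kernels belong to the space\<close>

text \<open>A family closed under directional and Wirtinger derivatives, with derivatives acting on
  the coefficients \<open>a\<close> and \<open>b\<close>. The kernel is the member with coefficients
  1, 1 and -1, so its regularity and pluriharmonicity reduce to algebra.\<close>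

definition exp_comb :: "real \<Rightarrow> complex^'n::finite \<Rightarrow> complex \<Rightarrow> complex \<Rightarrow> complex \<Rightarrow> complex^'n \<Rightarrow> complex" where
  "exp_comb \<alpha> w a b c v =
     a * exp (herm v w / of_real \<alpha>) + b * exp (herm w v / of_real \<alpha>) + c"

lemma has_derivative_exp_comb:
  "(exp_comb \<alpha> w a b c has_derivative
     (\<lambda>h. exp_comb \<alpha> w (a * herm h w / of_real \<alpha>) (b * herm w h / of_real \<alpha>) 0 v)) (at v)"
proof -
  have lin: "bounded_linear (\<lambda>v. herm v w / of_real \<alpha>)" "bounded_linear (\<lambda>v. herm w v / of_real \<alpha>)"
    by (rule bounded_linear_compose[OF bounded_linear_divide bounded_linear_herm_left]
        bounded_linear_compose[OF bounded_linear_divide bounded_linear_herm_right])+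
  note exp = has_derivative_compose[OF bounded_linear_imp_has_derivative
      DERIV_exp[unfolded has_field_derivative_def]]
  show ?thesis
    unfolding exp_comb_def[abs_def]
    by (rule has_derivative_eq_rhs, (rule has_derivative_add
          has_derivative_mult_right exp[OF lin(1)] exp[OF lin(2)] has_derivative_const)+) (simp add: fun_eq_iff mult_ac)
qed

lemma frechet_derivative_exp_comb:
  "frechet_derivative (exp_comb \<alpha> w a b c) (at v) h =
     exp_comb \<alpha> w (a * herm h w / of_real \<alpha>) (b * herm w h / of_real \<alpha>) 0 v"
  by (rule fun_cong[OF frechet_derivative_at[OF has_derivative_exp_comb], symmetric])

lemma herm_axis_left: "herm (axis k c) w = c * cnj (w $ k)"
  and herm_axis_right: "herm w (axis k c) = w $ k * cnj c"
  by (simp_all add: herm_def axis_def if_distrib if_distribR cong: if_cong)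

lemma wirtinger_exp_comb:
  assumes "\<alpha> > 0"
  shows "wirtinger k (exp_comb \<alpha> w a b c) = exp_comb \<alpha> w (a * cnj (w $ k) / of_real \<alpha>) 0 0"
    and "wirtinger_bar k (exp_comb \<alpha> w a b c) = exp_comb \<alpha> w 0 (b * w $ k / of_real \<alpha>) 0"
proof -
  have \<alpha>: "of_real \<alpha> \<noteq> (0 :: complex)"
    using assms by simp
  show "wirtinger k (exp_comb \<alpha> w a b c) = exp_comb \<alpha> w (a * cnj (w $ k) / of_real \<alpha>) 0 0"
    by (rule ext, unfold wirtinger_def frechet_derivative_exp_comb exp_comb_def herm_axis_left herm_axis_right)
       (use \<alpha> in \<open>simp add: divide_simps\<close>, simp add: algebra_simps)
  show "wirtinger_bar k (exp_comb \<alpha> w a b c) = exp_comb \<alpha> w 0 (b * w $ k / of_real \<alpha>) 0"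
    by (rule ext, unfold wirtinger_bar_def frechet_derivative_exp_comb exp_comb_def herm_axis_left herm_axis_right)
       (use \<alpha> in \<open>simp add: divide_simps\<close>, simp add: algebra_simps)
qed

lemma pluriharmonic_exp_comb:
  assumes "\<alpha> > 0"
  shows "pluriharmonic (exp_comb \<alpha> w a b c)"
proof -
  have diff: "exp_comb \<alpha> w a b c differentiable at v" for a b c v
    using has_derivative_exp_comb unfolding differentiable_def by blast
  have "continuous_on UNIV (exp_comb \<alpha> w a b c)" for a b c
    by (simp add: diff continuous_at_imp_continuous_on differentiable_imp_continuous_within)
  then have "C2 (exp_comb \<alpha> w a b c)"
    by (simp add: C2_def frechet_derivative_exp_comb diff)
  moreover have "exp_comb \<alpha> w 0 0 0 = (\<lambda>_. 0)"
    by (simp add: exp_comb_def fun_eq_iff)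
  ultimately show ?thesis
    by (simp add: pluriharmonic_def wirtinger_exp_comb[OF assms])
qed

lemma K_ph_in_PH2:
  assumes "\<alpha> > 0"
  shows "(\<lambda>v. K_ph \<alpha> v w) \<in> PH2 \<alpha>"
proof -
  have "(\<lambda>v. K_ph \<alpha> v w) = exp_comb \<alpha> w 1 1 (- 1)"
    by (simp add: fun_eq_iff K_ph_def exp_comb_def)
  then have "pluriharmonic (\<lambda>v. K_ph \<alpha> v w)"
    by (simp add: pluriharmonic_exp_comb[OF assms])
  moreover have "(\<lambda>v. norm (of_real (gauss \<alpha> v) * (K_ph \<alpha> v w * K_ph \<alpha> v w))) =
      (\<lambda>v. (norm (K_ph \<alpha> v w))\<^sup>2 * exp (- (norm v)\<^sup>2 / \<alpha>))"
    by (rule ext) (simp only: norm_mult norm_of_real power2_eq_square gauss_def abs_exp_cancel mult.commute)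
  ultimately show ?thesis
    using integrable_norm[OF integrable_K_ph_mult[OF assms, of w w]] unfolding PH2_def by simp
qed

lemma PH2_measurable [measurable_dest]:
  assumes "f \<in> PH2 \<alpha>"
  shows "f \<in> borel_measurable borel"
proof -
  have "\<forall>x. f differentiable at x"
    using assms by (simp add: PH2_def pluriharmonic_def C2_def)
  then have "continuous_on UNIV f"
    by (simp add: continuous_at_imp_continuous_on differentiable_imp_continuous_within)
  then show ?thesis by (rule borel_measurable_continuous_onI)
qed

lemma K_ph_in_kernel_span: "(\<lambda>v. K_ph \<alpha> v w) \<in> kernel_span \<alpha>"
  unfolding kernel_span_def
  by (rule CollectI, rule exI[of _ "{w}"], rule exI[of _ "\<lambda>_. 1"]) simp

section \<open>Square-integrable functions and Schmidt expansions\<close>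

text \<open>Functions rather than classes modulo null sets, to match \<open>PH2\<close>. The form is
  thus only semidefinite, which suffices for the Cauchy-Schwarz and Bessel inequalities.\<close>

definition l2_space :: "'a measure \<Rightarrow> ('a \<Rightarrow> complex) set" where
  "l2_space M = {f \<in> borel_measurable M. integrable M (\<lambda>x. (norm (f x))\<^sup>2)}"

definition l2_inner :: "'a measure \<Rightarrow> ('a \<Rightarrow> complex) \<Rightarrow> ('a \<Rightarrow> complex) \<Rightarrow> complex" where
  "l2_inner M f g = (LINT x|M. f x * cnj (g x))"

lemma l2_measurable [measurable_dest]: "f \<in> l2_space M \<Longrightarrow> f \<in> borel_measurable M"
  by (simp add: l2_space_def)

lemma l2_zero [simp]: "(\<lambda>_. 0) \<in> l2_space M"
  by (simp add: l2_space_def)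

lemma borel_measurable_cnj [measurable]:
  assumes [measurable]: "f \<in> borel_measurable M"
  shows "(\<lambda>x. cnj (f x)) \<in> borel_measurable M"
proof -
  have "cnj \<in> borel_measurable borel"
    by (intro borel_measurable_continuous_onI continuous_intros)
  then show ?thesis
    by measurable
qed

lemma integrable_l2_mult:
  assumes f: "f \<in> l2_space M" and g: "g \<in> l2_space M"
  shows "integrable M (\<lambda>x. f x * cnj (g x))"
proof (rule Bochner_Integration.integrable_bound)
  have [measurable]: "f \<in> borel_measurable M" "g \<in> borel_measurable M"
    using f g by (auto dest: l2_measurable)
  show "(\<lambda>x. f x * cnj (g x)) \<in> borel_measurable M"
    by measurable
  show "integrable M (\<lambda>x. (norm (f x))\<^sup>2 + (norm (g x))\<^sup>2)"
    using f g by (simp add: l2_space_def)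
  have "norm (f x * cnj (g x)) \<le> (norm (f x))\<^sup>2 + (norm (g x))\<^sup>2" for x
  proof -
    have "0 \<le> norm (f x) * norm (g x)" by simp
    then show ?thesis
      using sum_squares_bound[of "norm (f x)" "norm (g x)"]
      unfolding norm_mult complex_mod_cnj mult.assoc by linarith
  qed
  then show "AE x in M. norm (f x * cnj (g x)) \<le> norm ((norm (f x))\<^sup>2 + (norm (g x))\<^sup>2)"
    by simp
qed

lemma l2_cmult: "f \<in> l2_space M \<Longrightarrow> (\<lambda>x. c * f x) \<in> l2_space M"
  by (auto simp: l2_space_def norm_mult power_mult_distrib)

lemma l2_add:
  assumes f: "f \<in> l2_space M" and g: "g \<in> l2_space M"
  shows "(\<lambda>x. f x + g x) \<in> l2_space M"
proof -
  have [measurable]: "f \<in> borel_measurable M" "g \<in> borel_measurable M"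
    using f g by (auto dest: l2_measurable)
  have "integrable M (\<lambda>x. (norm (f x + g x))\<^sup>2)"
  proof (rule Bochner_Integration.integrable_bound)
    show "integrable M (\<lambda>x. 2 * (norm (f x))\<^sup>2 + 2 * (norm (g x))\<^sup>2)"
      using f g by (simp add: l2_space_def)
    have "(norm (f x + g x))\<^sup>2 \<le> 2 * (norm (f x))\<^sup>2 + 2 * (norm (g x))\<^sup>2" for x
    proof -
      have "(norm (f x + g x))\<^sup>2 \<le> (norm (f x) + norm (g x))\<^sup>2"
        by (intro power_mono norm_triangle_ineq) auto
      then show ?thesis
        using sum_squares_bound[of "norm (f x)" "norm (g x)"] by (simp add: power2_sum)
    qed
    then show "AE x in M. norm ((norm (f x + g x))\<^sup>2) \<le> norm (2 * (norm (f x))\<^sup>2 + 2 * (norm (g x))\<^sup>2)"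
      by simp
  qed measurable
  then show ?thesis
    by (simp add: l2_space_def)
qed

lemma l2_diff:
  assumes f: "f \<in> l2_space M" and g: "g \<in> l2_space M"
  shows "(\<lambda>x. f x - g x) \<in> l2_space M"
  using l2_add[OF f l2_cmult[OF g, of "- 1"]] by simp

lemma l2_sum:
  assumes "\<And>k. k \<in> A \<Longrightarrow> f k \<in> l2_space M"
  shows "(\<lambda>x. \<Sum>k\<in>A. f k x) \<in> l2_space M"
  using assms by (induction A rule: infinite_finite_induct) (auto intro: l2_add)

lemma l2_inner_commute: "l2_inner M g f = cnj (l2_inner M f g)"
proof -
  have "cnj (l2_inner M f g) = (LINT x|M. cnj (f x * cnj (g x)))"
    unfolding l2_inner_def by (rule Bochner_Integration.integral_cnj[symmetric])
  then show ?thesis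
    by (simp add: l2_inner_def mult.commute)
qed

lemma l2_inner_cmult_left: "l2_inner M (\<lambda>x. c * f x) g = c * l2_inner M f g"
  by (simp add: l2_inner_def mult.assoc)

lemma l2_inner_diff_left:
  assumes "f \<in> l2_space M" "g \<in> l2_space M" "h \<in> l2_space M"
  shows "l2_inner M (\<lambda>x. f x - g x) h = l2_inner M f h - l2_inner M g h"
  using assms by (simp add: l2_inner_def left_diff_distrib integrable_l2_mult)

lemma l2_inner_sum_left:
  assumes "\<And>k. k \<in> A \<Longrightarrow> f k \<in> l2_space M" "h \<in> l2_space M"
  shows "l2_inner M (\<lambda>x. \<Sum>k\<in>A. f k x) h = (\<Sum>k\<in>A. l2_inner M (f k) h)"
  using assms by (simp add: l2_inner_def sum_distrib_right integrable_l2_mult)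

lemma l2_inner_diff_right:
  assumes "f \<in> l2_space M" "g \<in> l2_space M" "h \<in> l2_space M"
  shows "l2_inner M h (\<lambda>x. f x - g x) = l2_inner M h f - l2_inner M h g"
  using l2_inner_diff_left[OF assms] l2_inner_commute by (metis complex_cnj_diff)

lemma l2_inner_self: "l2_inner M f f = of_real (LINT x|M. (norm (f x))\<^sup>2)"
  by (simp add: l2_inner_def complex_norm_square[symmetric] of_real_power[symmetric] del: of_real_power)

lemma Re_l2_inner_self: "Re (l2_inner M f f) = (LINT x|M. (norm (f x))\<^sup>2)"
  by (simp add: l2_inner_self)

lemma Re_l2_inner_self_nonneg [simp]: "Re (l2_inner M f f) \<ge> 0"
  by (simp add: Re_l2_inner_self)

lemma l2_Cauchy_Schwarz:
  assumes f: "f \<in> l2_space M" and g: "g \<in> l2_space M"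
  shows "norm (l2_inner M f g) \<le> ip_norm (l2_inner M) f * ip_norm (l2_inner M) g"
proof -
  have [measurable]: "f \<in> borel_measurable M" "g \<in> borel_measurable M"
    using f g by (auto dest: l2_measurable)
  have sq: "(\<integral>\<^sup>+x. (ennreal (norm (h x)))\<^sup>2 \<partial>M) = ennreal (Re (l2_inner M h h))"
    if "h \<in> l2_space M" for h
    using that by (simp add: Re_l2_inner_self ennreal_power nn_integral_eq_integral l2_space_def)
  have int: "integrable M (\<lambda>x. norm (f x) * norm (g x))"
    using integrable_norm[OF integrable_l2_mult[OF f g]] by (simp add: norm_mult)
  have "(\<integral>\<^sup>+x. ennreal (norm (f x)) * ennreal (norm (g x)) \<partial>M)\<^sup>2
      \<le> (\<integral>\<^sup>+x. (ennreal (norm (f x)))\<^sup>2 \<partial>M) * (\<integral>\<^sup>+x. (ennreal (norm (g x)))\<^sup>2 \<partial>M)"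
    by (rule Cauchy_Schwarz_nn_integral) auto
  also have "(\<integral>\<^sup>+x. ennreal (norm (f x)) * ennreal (norm (g x)) \<partial>M)
      = ennreal (LINT x|M. norm (f x) * norm (g x))"
    using int by (simp add: ennreal_mult[symmetric] nn_integral_eq_integral)
  finally have "(LINT x|M. norm (f x) * norm (g x))\<^sup>2 \<le> Re (l2_inner M f f) * Re (l2_inner M g g)"
    unfolding sq[OF f] sq[OF g] by (simp add: ennreal_power ennreal_mult[symmetric])
  moreover have "norm (l2_inner M f g) \<le> (LINT x|M. norm (f x) * norm (g x))"
    using integral_norm_bound[of M "\<lambda>x. f x * cnj (g x)"] by (simp add: l2_inner_def norm_mult)
  ultimately have "(norm (l2_inner M f g))\<^sup>2 \<le> Re (l2_inner M f f) * Re (l2_inner M g g)"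
    by (meson norm_ge_zero order_trans power_mono)
  then show ?thesis
    by (simp add: ip_norm_def real_sqrt_mult[symmetric] real_le_rsqrt)
qed

lemma l2_Bessel:
  assumes g: "g \<in> l2_space M" and A: "finite A"
    and e: "\<And>k. k \<in> A \<Longrightarrow> e k \<in> l2_space M"
    and orth: "\<And>k l. k \<in> A \<Longrightarrow> l \<in> A \<Longrightarrow> l2_inner M (e k) (e l) = (if k = l then 1 else 0)"
  shows "(\<Sum>k\<in>A. (norm (l2_inner M g (e k)))\<^sup>2) \<le> Re (l2_inner M g g)"
proof -
  define c where "c k = l2_inner M g (e k)" for k
  define x where "x = (\<lambda>v. \<Sum>k\<in>A. c k * e k v)"
  have x: "x \<in> l2_space M"
    unfolding x_def by (intro l2_sum l2_cmult e)
  have left: "l2_inner M x h = (\<Sum>k\<in>A. c k * l2_inner M (e k) h)" if "h \<in> l2_space M" for h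
    unfolding x_def using that e by (simp add: l2_inner_sum_left l2_cmult l2_inner_cmult_left)
  define S where "S = (\<Sum>k\<in>A. (norm (c k))\<^sup>2)"
  have xg: "l2_inner M x g = of_real S"
    using left[OF g] unfolding S_def c_def
    by (simp add: l2_inner_commute[of M _ g] complex_norm_square[symmetric] of_real_power[symmetric] del: of_real_power)
  then have gx: "l2_inner M g x = of_real S"
    by (metis l2_inner_commute complex_cnj_complex_of_real)
  have "l2_inner M x x = (\<Sum>k\<in>A. c k * cnj (l2_inner M x (e k)))"
    unfolding left[OF x] by (intro sum.cong arg_cong2[where f = "(*)"] refl l2_inner_commute)
  also have "\<dots> = (\<Sum>k\<in>A. c k * cnj (c k))"
  proof (intro sum.cong refl)
    fix k assume "k \<in> A"
    then have "l2_inner M x (e k) = (\<Sum>l\<in>A. if l = k then c l else 0)"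
      using left[OF e] orth by (auto intro!: sum.cong)
    then show "c k * cnj (l2_inner M x (e k)) = c k * cnj (c k)"
      using A \<open>k \<in> A\<close> by simp
  qed
  also have "\<dots> = of_real S"
    by (simp add: S_def complex_norm_square[symmetric] of_real_power[symmetric] del: of_real_power)
  finally have xx: "l2_inner M x x = of_real S" .
  have "l2_inner M (\<lambda>v. g v - x v) (\<lambda>v. g v - x v) = l2_inner M g g - of_real S"
    using g x by (simp add: l2_inner_diff_left l2_inner_diff_right l2_diff xg gx xx)
  moreover have "0 \<le> Re (l2_inner M (\<lambda>v. g v - x v) (\<lambda>v. g v - x v))"
    by simp
  ultimately show ?thesis
    by (simp add: S_def c_def)
qed

text \<open>Jensen's inequality for the p-th power with the probability weights
  \<open>a k / B\<close>, where \<open>B\<close> is the total mass. Homogeneity leaves the factor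
  \<open>B powr (p - 1)\<close>, which is increasing in \<open>B\<close> because
  \<open>p \<ge> 1\<close>.\<close>

lemma sum_mult_powr_le:
  fixes s a :: "'i \<Rightarrow> real"
  assumes p: "p \<ge> 1" and s: "\<And>k. k \<in> I \<Longrightarrow> s k > 0" and a: "\<And>k. k \<in> I \<Longrightarrow> a k \<ge> 0"
    and I: "finite I" and A: "(\<Sum>k\<in>I. a k) \<le> A"
  shows "(\<Sum>k\<in>I. s k * a k) powr p \<le> A powr (p - 1) * (\<Sum>k\<in>I. s k powr p * a k)"
proof -
  define B where "B = (\<Sum>k\<in>I. a k)"
  show ?thesis
  proof (cases "B = 0")
    case True
    then have "a k = 0" if "k \<in> I" for k
      using that a I by (simp add: B_def sum_nonneg_eq_0_iff)
    then show ?thesis by simp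
  next
    case False
    then have B: "B > 0"
      using a by (simp add: B_def sum_nonneg less_le)
    have "(\<Sum>k\<in>I. (a k / B) *\<^sub>R s k) powr p \<le> (\<Sum>k\<in>I. (a k / B) * s k powr p)"
    proof (rule convex_on_sum[OF I _ powr_convex[OF p]])
      show "I \<noteq> {}" using False by (auto simp: B_def)
      show "(\<Sum>k\<in>I. a k / B) = 1"
        using False by (simp add: sum_divide_distrib[symmetric] B_def)
    qed (use a s B in auto)
    moreover have "(\<Sum>k\<in>I. (a k / B) *\<^sub>R s k) = (\<Sum>k\<in>I. s k * a k) / B"
      by (simp add: sum_divide_distrib mult.commute)
    moreover have "(\<Sum>k\<in>I. (a k / B) * s k powr p) = (\<Sum>k\<in>I. s k powr p * a k) / B"
      by (simp add: sum_divide_distrib mult.commute)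
    ultimately have "((\<Sum>k\<in>I. s k * a k) / B) powr p \<le> (\<Sum>k\<in>I. s k powr p * a k) / B"
      by simp
    moreover have "(\<Sum>k\<in>I. s k * a k) \<ge> 0"
      using a s by (intro sum_nonneg mult_nonneg_nonneg) (auto simp: less_imp_le)
    ultimately have "(\<Sum>k\<in>I. s k * a k) powr p / B powr p \<le> (\<Sum>k\<in>I. s k powr p * a k) / B"
      using B by (simp add: powr_divide)
    then have "(\<Sum>k\<in>I. s k * a k) powr p \<le> B powr p * ((\<Sum>k\<in>I. s k powr p * a k) / B)"
      using B by (simp add: divide_le_eq mult.commute)
    also have "\<dots> = B powr (p - 1) * (\<Sum>k\<in>I. s k powr p * a k)"
      using B by (simp add: powr_diff)
    also have "\<dots> \<le> A powr (p - 1) * (\<Sum>k\<in>I. s k powr p * a k)"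
      using A B p a by (intro mult_right_mono powr_mono2 sum_nonneg) (auto simp: B_def)
    finally show ?thesis .
  qed
qed

text \<open>Orthonormality is consumed here through Bessel's inequality; afterwards only the norms
  of the vectors matter, so they are delivered as total sequences in the unit ball. The bound is
  stated in \<open>ennreal\<close>, so that it can be integrated term by term.\<close>

lemma schatten_diagonal_bound:
  assumes T: "T \<in> schatten_class H (l2_inner M) p" and H: "H \<subseteq> l2_space M" and p: "p \<ge> 1"
  obtains e u s where "\<And>k. e k \<in> l2_space M" "\<And>k. u k \<in> l2_space M"
    "\<And>k. Re (l2_inner M (e k) (e k)) \<le> 1" "\<And>k. Re (l2_inner M (u k) (u k)) \<le> 1"
    "summable (\<lambda>k::nat. s k powr p)"
    "\<And>g. g \<in> H \<Longrightarrow> ennreal (norm (l2_inner M (T g) g) powr p) \<le>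
       ennreal (Re (l2_inner M g g) powr (p - 1)) *
       (\<Sum>k. ennreal (s k powr p) * ennreal ((norm (l2_inner M g (e k)))\<^sup>2 + (norm (l2_inner M g (u k)))\<^sup>2))"
proof -
  obtain s where s_vals: "has_singular_values H (l2_inner M) T s"
    and s_sum: "summable (\<lambda>k. s k powr p)"
    using T unfolding schatten_class_def by blast
  then obtain e0 u0 where e0: "orthonormal_family H (l2_inner M) {k. s k \<noteq> 0} e0"
    and u0: "orthonormal_family H (l2_inner M) {k. s k \<noteq> 0} u0"
    and lim: "\<And>g. g \<in> H \<Longrightarrow> (\<lambda>N. ip_norm (l2_inner M)
        (\<lambda>x. T g x - (\<Sum>k | k < N \<and> s k \<noteq> 0. of_real (s k) * l2_inner M g (e0 k) * u0 k x)))
        \<longlonglongrightarrow> 0"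
    unfolding has_singular_values_def by blast
  have s: "\<And>k. 0 \<le> s k"
    using s_vals unfolding has_singular_values_def by blast
  have TH: "T g \<in> l2_space M" if "g \<in> H" for g
    using T H that unfolding schatten_class_def bounded_operator_on_def by auto
  \<comment> \<open>Where \<open>s k = 0\<close> the Schmidt vectors are arbitrary and may lie
    outside the space, so they are replaced by zero.\<close>
  define e where "e k = (if s k \<noteq> 0 then e0 k else (\<lambda>_. 0))" for k
  define u where "u k = (if s k \<noteq> 0 then u0 k else (\<lambda>_. 0))" for k
  have e0': "e0 k \<in> l2_space M" "u0 k \<in> l2_space M" if "s k \<noteq> 0" for k
    using e0 u0 H that unfolding orthonormal_family_def by auto
  have eu: "e k \<in> l2_space M" "u k \<in> l2_space M" for k
    using e0' by (auto simp: e_def u_def)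
  have le1: "Re (l2_inner M (e k) (e k)) \<le> 1" "Re (l2_inner M (u k) (u k)) \<le> 1" for k
    using e0 u0 unfolding orthonormal_family_def e_def u_def by (auto simp: l2_inner_def)
  have bound: "ennreal (norm (l2_inner M (T g) g) powr p) \<le>
       ennreal (Re (l2_inner M g g) powr (p - 1)) *
       (\<Sum>k. ennreal (s k powr p) * ennreal ((norm (l2_inner M g (e k)))\<^sup>2 + (norm (l2_inner M g (u k)))\<^sup>2))"
    (is "_ \<le> ?A * ?S") if "g \<in> H" for g
  proof -
    have g: "g \<in> l2_space M" using that H by auto
    define I where "I N = {k. k < N \<and> s k \<noteq> 0}" for N
    have I: "finite (I N)" for N by (simp add: I_def)
    define P where "P N = (\<lambda>x. \<Sum>k\<in>I N. of_real (s k) * l2_inner M g (e0 k) * u0 k x)" for N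
    have P: "P N \<in> l2_space M" for N
      unfolding P_def by (intro l2_sum l2_cmult e0') (auto simp: I_def)
    have "(\<lambda>N. l2_inner M (\<lambda>x. T g x - P N x) g) \<longlonglongrightarrow> 0"
    proof (rule Lim_null_comparison)
      show "\<forall>\<^sub>F N in sequentially. norm (l2_inner M (\<lambda>x. T g x - P N x) g) \<le>
          ip_norm (l2_inner M) (\<lambda>x. T g x - P N x) * ip_norm (l2_inner M) g"
        by (intro always_eventually allI l2_Cauchy_Schwarz l2_diff TH that P g)
      show "(\<lambda>N. ip_norm (l2_inner M) (\<lambda>x. T g x - P N x) * ip_norm (l2_inner M) g) \<longlonglongrightarrow> 0"
        using tendsto_mult_left_zero[OF lim[OF that]] by (simp add: P_def I_def)
    qed
    then have "(\<lambda>N. l2_inner M (T g) g - l2_inner M (P N) g) \<longlonglongrightarrow> 0"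
      by (simp add: l2_inner_diff_left TH that P g)
    then have "(\<lambda>N. l2_inner M (T g) g - (l2_inner M (T g) g - l2_inner M (P N) g))
        \<longlonglongrightarrow> l2_inner M (T g) g - 0"
      by (intro tendsto_intros)
    then have "(\<lambda>N. l2_inner M (P N) g) \<longlonglongrightarrow> l2_inner M (T g) g"
      by simp
    then have "(\<lambda>N. ennreal (norm (l2_inner M (P N) g) powr p))
        \<longlonglongrightarrow> ennreal (norm (l2_inner M (T g) g) powr p)"
      using p by (intro tendsto_ennrealI tendsto_powr2 tendsto_norm tendsto_const) auto
    moreover have "ennreal (norm (l2_inner M (P N) g) powr p) \<le> ?A * ?S" for N
    proof -
      \<comment> \<open>The two Schmidt families differ, so the product of their coefficients is
        replaced by the arithmetic mean of the squares. Bessel for each family bounds the sum of the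
        means by the squared norm of \<open>g\<close>.\<close>
      define a where "a k = ((norm (l2_inner M g (e k)))\<^sup>2 + (norm (l2_inner M g (u k)))\<^sup>2) / 2" for k
      have a: "a k \<ge> 0" for k by (simp add: a_def)
      have "l2_inner M (P N) g = (\<Sum>k\<in>I N. of_real (s k) * l2_inner M g (e k) * l2_inner M (u k) g)"
        unfolding P_def using e0' g
        by (subst l2_inner_sum_left) (auto simp: l2_cmult l2_inner_cmult_left I_def e_def u_def)
      also have "norm \<dots> \<le> (\<Sum>k\<in>I N. s k * a k)"
      proof (rule order_trans[OF norm_sum], rule sum_mono)
        fix k
        have "norm (l2_inner M g (e k)) * norm (l2_inner M (u k) g) \<le> a k"
          using sum_squares_bound[of "norm (l2_inner M g (e k))" "norm (l2_inner M g (u k))"]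
          by (simp add: a_def l2_inner_commute[of M "u k" g])
        then show "norm (of_real (s k) * l2_inner M g (e k) * l2_inner M (u k) g) \<le> s k * a k"
          using s[of k] by (simp add: norm_mult mult.assoc mult_left_mono)
      qed
      finally have 1: "norm (l2_inner M (P N) g) powr p \<le> (\<Sum>k\<in>I N. s k * a k) powr p"
        using p by (intro powr_mono2) auto
      have "(\<Sum>k\<in>I N. (norm (l2_inner M g (e k)))\<^sup>2) \<le> Re (l2_inner M g g)"
        using e0 e0' by (intro l2_Bessel g I) (auto simp: I_def e_def orthonormal_family_def)
      moreover have "(\<Sum>k\<in>I N. (norm (l2_inner M g (u k)))\<^sup>2) \<le> Re (l2_inner M g g)"
        using u0 e0' by (intro l2_Bessel g I) (auto simp: I_def u_def orthonormal_family_def)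
      ultimately have "(\<Sum>k\<in>I N. a k) \<le> Re (l2_inner M g g)"
        by (simp add: a_def sum_divide_distrib[symmetric] sum.distrib)
      then have 2: "(\<Sum>k\<in>I N. s k * a k) powr p
          \<le> Re (l2_inner M g g) powr (p - 1) * (\<Sum>k\<in>I N. s k powr p * a k)"
        using s a by (intro sum_mult_powr_le p I) (auto simp: I_def less_le)
      have "ennreal (norm (l2_inner M (P N) g) powr p)
          \<le> ennreal (Re (l2_inner M g g) powr (p - 1) * (\<Sum>k\<in>I N. s k powr p * a k))"
        using 1 2 by (intro ennreal_leI) linarith
      also have "\<dots> = ?A * (\<Sum>k\<in>I N. ennreal (s k powr p) * ennreal (a k))"
      proof -
        have "(\<Sum>k\<in>I N. ennreal (s k powr p) * ennreal (a k)) = (\<Sum>k\<in>I N. ennreal (s k powr p * a k))"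
          using a by (simp add: ennreal_mult)
        also have "\<dots> = ennreal (\<Sum>k\<in>I N. s k powr p * a k)"
          using a by (intro sum_ennreal) simp
        finally show ?thesis
          by (simp add: ennreal_mult')
      qed
      also have "(\<Sum>k\<in>I N. ennreal (s k powr p) * ennreal (a k)) \<le> (\<Sum>k\<in>I N. ennreal (s k powr p) *
          ennreal ((norm (l2_inner M g (e k)))\<^sup>2 + (norm (l2_inner M g (u k)))\<^sup>2))"
        by (intro sum_mono mult_left_mono ennreal_leI) (auto simp: a_def)
      also have "\<dots> \<le> ?S"
        by (intro sum_le_suminf I) auto
      finally show ?thesis
        by (simp add: mult_left_mono)
    qed
    ultimately show ?thesis
      using LIMSEQ_le_const2 by blast
  qed
  show thesis
    by (rule that[of e u s]) (use eu le1 s_sum bound in auto)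
qed

section \<open>Measures with square-integrable kernels\<close>

text \<open>The squares are those of the kernels at z and 2z, with x the real part and y the
  imaginary part of \<open>herm z w / \<alpha>\<close>. If the cosine of y is below 1/2 in absolute
  value, the double angle formula makes that of 2y at least 1/2, so one kernel is always large when
  x > 0. The constant 5 absorbs the case \<open>x \<le> 0\<close> and the summand -1 of the
  kernels.\<close>

lemma exp_double_le_kernels:
  fixes x y :: real
  shows "exp (2 * x) \<le> 5 + 2 * (2 * exp x * cos y - 1)\<^sup>2 + 2 * (2 * exp (2 * x) * cos (2 * y) - 1)\<^sup>2"
proof -
  have sq: "(t + 1)\<^sup>2 \<le> 2 * t\<^sup>2 + 2" for t :: real
    using sum_squares_bound[of t 1] by (simp add: power2_sum)
  consider "x \<le> 0" | "x > 0" "(cos y)\<^sup>2 \<ge> 1 / 4" | "x > 0" "(cos y)\<^sup>2 < 1 / 4"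
    by linarith
  then show ?thesis
  proof cases
    case 1
    then have "exp (2 * x) \<le> 1" by simp
    then show ?thesis
      using zero_le_power2[of "2 * exp x * cos y - 1"] zero_le_power2[of "2 * exp (2 * x) * cos (2 * y) - 1"]
      by linarith
  next
    case 2
    have "exp (2 * x) * 1 \<le> exp (2 * x) * (4 * (cos y)\<^sup>2)"
      using 2 by (intro mult_left_mono) auto
    also have "\<dots> = (2 * exp x * cos y)\<^sup>2"
      by (simp add: power_mult_distrib exp_double)
    also have "\<dots> \<le> 2 * (2 * exp x * cos y - 1)\<^sup>2 + 2"
      using sq[of "2 * exp x * cos y - 1"] by simp
    finally show ?thesis
      using zero_le_power2[of "2 * exp (2 * x) * cos (2 * y) - 1"] by linarith
  next
    case 3
    have "(1 / 2)\<^sup>2 \<le> (cos (2 * y))\<^sup>2"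
      using 3 unfolding abs_le_square_iff[symmetric] by (simp add: cos_double_cos)
    then have "1 \<le> 4 * (cos (2 * y))\<^sup>2"
      by (simp add: power2_eq_square)
    moreover have "exp (2 * x) \<le> exp (4 * x)"
      using 3 by simp
    ultimately have "exp (2 * x) * 1 \<le> exp (4 * x) * (4 * (cos (2 * y))\<^sup>2)"
      by (intro mult_mono) auto
    also have "\<dots> = (2 * exp (2 * x) * cos (2 * y))\<^sup>2"
      using exp_double[of "2 * x"] by (simp add: power_mult_distrib)
    also have "\<dots> \<le> 2 * (2 * exp (2 * x) * cos (2 * y) - 1)\<^sup>2 + 2"
      using sq[of "2 * exp (2 * x) * cos (2 * y) - 1"] by simp
    finally show ?thesis
      using zero_le_power2[of "2 * exp x * cos y - 1"] by linarith
  qed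
qed

text \<open>The largest coordinate is at least \<open>norm w / DIM('a)\<close> in absolute value.
  This passes from exponentials of linear functionals to an exponential of the norm.\<close>

lemma exp_norm_le_sum_Basis:
  fixes w :: "'a::euclidean_space"
  assumes "c \<ge> 0"
  shows "exp (c * norm w) \<le>
    (\<Sum>b\<in>Basis. exp (c * DIM('a) * (w \<bullet> b)) + exp (- (c * DIM('a) * (w \<bullet> b))))"
proof -
  define m where "m = Max ((\<lambda>b. \<bar>w \<bullet> b\<bar>) ` (Basis :: 'a set))"
  have "m \<in> (\<lambda>b. \<bar>w \<bullet> b\<bar>) ` (Basis :: 'a set)"
    unfolding m_def by (rule Max_in) auto
  then obtain b where b: "b \<in> Basis" "m = \<bar>w \<bullet> b\<bar>"
    by auto
  have "norm w \<le> (\<Sum>b\<in>Basis. \<bar>w \<bullet> b\<bar>)"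
    by (rule norm_le_l1)
  also have "\<dots> \<le> real DIM('a) * m"
    by (rule sum_bounded_above) (simp add: m_def)
  finally have "c * norm w \<le> c * DIM('a) * \<bar>w \<bullet> b\<bar>"
    using assms b by (simp add: mult.assoc mult_left_mono)
  then have "exp (c * norm w) \<le> exp (c * DIM('a) * \<bar>w \<bullet> b\<bar>)"
    by simp
  also have "\<dots> \<le> exp (c * DIM('a) * (w \<bullet> b)) + exp (- (c * DIM('a) * (w \<bullet> b)))"
    by (cases "w \<bullet> b \<ge> 0") (simp_all add: add_increasing add_increasing2)
  also have "\<dots> \<le> (\<Sum>b\<in>Basis. exp (c * DIM('a) * (w \<bullet> b)) + exp (- (c * DIM('a) * (w \<bullet> b))))"
    using b(1) by (intro member_le_sum) (auto simp: add_nonneg_nonneg)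
  finally show ?thesis .
qed

locale kernel_measure =
  fixes \<alpha> :: real and \<mu> :: "(complex^'n::finite) measure"
  assumes \<alpha>: "\<alpha> > 0"
    and sets_\<mu> [measurable_cong]: "sets \<mu> = sets borel"
    and kernel_finite: "\<And>z. (\<integral>\<^sup>+w. ennreal ((norm (K_ph \<alpha> z w))\<^sup>2 * exp (- (norm w)\<^sup>2 / \<alpha>)) \<partial>\<mu>) < \<infinity>"
begin

lemma integrable_kernel_sq: "integrable \<mu> (\<lambda>w. (norm (K_ph \<alpha> z w))\<^sup>2 * gauss \<alpha> w)"
proof (rule integrableI_bounded)
  show "(\<integral>\<^sup>+w. ennreal (norm ((norm (K_ph \<alpha> z w))\<^sup>2 * gauss \<alpha> w)) \<partial>\<mu>) < \<infinity>"
    using kernel_finite[of z] by (simp add: gauss_def)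
qed measurable

text \<open>At \<open>z = 0\<close> the kernel is identically 1.\<close>

lemma integrable_gauss_\<mu>: "integrable \<mu> (gauss \<alpha>)"
  using integrable_kernel_sq[of 0] by (simp add: K_ph_def)

lemma integrable_exp_inner_\<mu>: "integrable \<mu> (\<lambda>w. exp (2 * (z \<bullet> w) / \<alpha>) * gauss \<alpha> w)"
proof (rule Bochner_Integration.integrable_bound)
  let ?K = "\<lambda>z w. (norm (K_ph \<alpha> z w))\<^sup>2"
  show "integrable \<mu> (\<lambda>w. 5 * gauss \<alpha> w + 2 * (?K z w * gauss \<alpha> w) + 2 * (?K (2 *\<^sub>R z) w * gauss \<alpha> w))"
    by (intro Bochner_Integration.integrable_add integrable_mult_right integrable_gauss_\<mu> integrable_kernel_sq)
  have "exp (2 * (z \<bullet> w) / \<alpha>) \<le> 5 + 2 * ?K z w + 2 * ?K (2 *\<^sub>R z) w" for w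
    using exp_double_le_kernels[of "z \<bullet> w / \<alpha>" "Im (herm z w) / \<alpha>"]
    unfolding K_ph_real norm_of_real power2_abs herm_scaleR_left
    by (simp add: mult.assoc)
  then have "exp (2 * (z \<bullet> w) / \<alpha>) * gauss \<alpha> w
      \<le> (5 + 2 * ?K z w + 2 * ?K (2 *\<^sub>R z) w) * gauss \<alpha> w" for w
    by (intro mult_right_mono) auto
  then have "norm (exp (2 * (z \<bullet> w) / \<alpha>) * gauss \<alpha> w)
      \<le> norm (5 * gauss \<alpha> w + 2 * (?K z w * gauss \<alpha> w) + 2 * (?K (2 *\<^sub>R z) w * gauss \<alpha> w))" for w
    by (simp add: algebra_simps abs_mult)
  then show "AE w in \<mu>. norm (exp (2 * (z \<bullet> w) / \<alpha>) * gauss \<alpha> w)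
      \<le> norm (5 * gauss \<alpha> w + 2 * (?K z w * gauss \<alpha> w) + 2 * (?K (2 *\<^sub>R z) w * gauss \<alpha> w))"
    by simp
qed measurable

text \<open>This is the form in which the hypothesis on \<mu> enters Fubini's theorem and dominated
  convergence.\<close>

lemma integrable_exp_norm_\<mu>:
  assumes "c \<ge> 0"
  shows "integrable \<mu> (\<lambda>w. exp (c * norm w) * gauss \<alpha> w)"
proof (rule Bochner_Integration.integrable_bound)
  let ?D = "c * DIM(complex^'n)"
  let ?E = "\<lambda>w::complex^'n. \<Sum>b\<in>Basis. exp (?D * (w \<bullet> b)) * gauss \<alpha> w + exp (- (?D * (w \<bullet> b))) * gauss \<alpha> w"
  \<comment> \<open>The point \<open>(\<alpha> * t / 2) *\<^sub>R b\<close> is chosen so that twice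
    its inner product with \<open>w\<close>, divided by \<alpha>, is
    \<open>t * (w \<bullet> b)\<close>.\<close>
  have "integrable \<mu> (\<lambda>w. exp (t * (w \<bullet> b)) * gauss \<alpha> w)" for t and b :: "complex^'n"
    using integrable_exp_inner_\<mu>[of "(\<alpha> * t / 2) *\<^sub>R b"] \<alpha> by (simp add: inner_commute)
  from this[of ?D] this[of "- ?D"] show "integrable \<mu> ?E"
    by (intro Bochner_Integration.integrable_sum Bochner_Integration.integrable_add) simp_all
  have "exp (c * norm w) * gauss \<alpha> w \<le> ?E w" for w :: "complex^'n"
    using mult_right_mono[OF exp_norm_le_sum_Basis[OF assms, of w] gauss_nonneg[of \<alpha> w]]
    by (simp add: sum_distrib_right distrib_right)
  then have "norm (exp (c * norm w) * gauss \<alpha> w) \<le> norm (?E w)" for w :: "complex^'n"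
    by (simp add: abs_mult) (meson abs_ge_self order_trans)
  then show "AE w in \<mu>. norm (exp (c * norm w) * gauss \<alpha> w) \<le> norm (?E w)"
    by simp
qed measurable

lemma emeasure_ball_finite: "emeasure \<mu> (ball z r) < \<infinity>"
proof -
  define R where "R = norm z + \<bar>r\<bar>"
  have le: "indicator (ball z r) w \<le> ennreal (exp (R\<^sup>2 / \<alpha>)) * ennreal (gauss \<alpha> w)" for w
  proof (cases "w \<in> ball z r")
    case True
    then have "norm w \<le> R"
      using norm_triangle_ineq2[of w z] by (simp add: R_def dist_norm norm_minus_commute)
    then have "(norm w)\<^sup>2 \<le> R\<^sup>2"
      by (intro power_mono) auto
    then have "(norm w)\<^sup>2 / \<alpha> \<le> R\<^sup>2 / \<alpha>"
      using \<alpha> by (simp add: divide_right_mono)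
    then have "1 \<le> exp (R\<^sup>2 / \<alpha>) * gauss \<alpha> w"
      by (simp add: gauss_def exp_add[symmetric])
    then show ?thesis
      using True by (simp add: ennreal_mult[symmetric])
  qed simp
  have "emeasure \<mu> (ball z r) = (\<integral>\<^sup>+w. indicator (ball z r) w \<partial>\<mu>)"
    by (simp add: sets_\<mu>)
  also have "\<dots> \<le> (\<integral>\<^sup>+w. ennreal (exp (R\<^sup>2 / \<alpha>)) * ennreal (gauss \<alpha> w) \<partial>\<mu>)"
    by (rule nn_integral_mono) (rule le)
  also have "\<dots> = ennreal (exp (R\<^sup>2 / \<alpha>)) * (\<integral>\<^sup>+w. ennreal (gauss \<alpha> w) \<partial>\<mu>)"
    by (rule nn_integral_cmult) measurable
  also have "\<dots> < \<infinity>"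
    using integrable_gauss_\<mu> by (simp add: integrable_iff_bounded ennreal_mult_less_top)
  finally show ?thesis .
qed

lemma space_\<mu>: "space \<mu> = UNIV"
  using sets_eq_imp_space_eq[OF sets_\<mu>] by simp

sublocale sigma_finite_measure \<mu>
proof
  let ?A = "range (\<lambda>n. ball (0::complex^'n) (real n))"
  have "\<Union> ?A = space \<mu>"
    by (auto simp: space_\<mu> intro: reals_Archimedean2)
  then show "\<exists>A. countable A \<and> A \<subseteq> sets \<mu> \<and> \<Union> A = space \<mu> \<and> (\<forall>a\<in>A. emeasure \<mu> a \<noteq> \<infinity>)"
    using emeasure_ball_finite by (intro exI[of _ ?A]) (auto simp: sets_\<mu> less_top)
qed

sublocale pair: pair_sigma_finite "lborel :: (complex^'n) measure" \<mu>
  by standard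

text \<open>The Berezin transform before normalisation. Its usual denominator
  \<open>K_ph \<alpha> z z\<close> equals \<open>2 / gauss \<alpha> z - 1\<close>, which lies
  between 1 and 2 times \<open>1 / gauss \<alpha> z\<close>; multiplying by
  \<open>gauss \<alpha> z\<close> therefore normalises up to a bounded factor.\<close>

definition berezin :: "complex^'n \<Rightarrow> real" where
  "berezin z = (LINT w|\<mu>. (norm (K_ph \<alpha> z w))\<^sup>2 * gauss \<alpha> w)"

lemma berezin_nonneg: "berezin z \<ge> 0"
  unfolding berezin_def by (rule Bochner_Integration.integral_nonneg) simp

lemma norm_K_ph_le_exp_norm: "norm (K_ph \<alpha> z w) \<le> 3 * exp (norm z * norm w / \<alpha>)"
proof -
  have "exp (z \<bullet> w / \<alpha>) \<le> exp (norm z * norm w / \<alpha>)"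
    using \<alpha> norm_cauchy_schwarz[of z w] by (simp add: divide_right_mono)
  moreover have "1 \<le> exp (norm z * norm w / \<alpha>)"
    using \<alpha> by simp
  ultimately show ?thesis
    using norm_K_ph_le[of \<alpha> z w] by linarith
qed

text \<open>With \<open>v\<close> confined to a ball, each kernel factor is at most exponential in
  \<open>norm w\<close>, so the joint integrand is absolutely integrable and Fubini's theorem
  applies.\<close>

lemma integral_trunc_toeplitz:
  fixes z :: "complex^'n"
  assumes "R \<ge> 0"
  shows "(LINT v|lborel. of_real (trunc_gauss \<alpha> R v) * (toeplitz \<alpha> \<mu> (\<lambda>w. K_ph \<alpha> w z) v * K_ph \<alpha> v z)) =
    (LINT w|\<mu>. (LINT v|lborel. of_real (trunc_gauss \<alpha> R v) * (K_ph \<alpha> v w * K_ph \<alpha> v z))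
        * K_ph \<alpha> w z * of_real (gauss \<alpha> w))"
proof -
  let ?f = "\<lambda>v w. of_real (trunc_gauss \<alpha> R v) * (K_ph \<alpha> v w * K_ph \<alpha> v z) * K_ph \<alpha> w z * of_real (gauss \<alpha> w)"
  \<comment> \<open>In the rate, \<open>R\<close> stems from the kernel at \<open>v\<close> and
    \<open>w\<close>, and \<open>norm z\<close> from the kernel at \<open>w\<close> and
    \<open>z\<close>. The 27 below is one factor 3 for each of the three kernels.\<close>
  define c where "c = (R + norm z) / \<alpha>"
  define A where "A = 27 * exp (R * norm z / \<alpha>)"
  have c: "c \<ge> 0"
    using assms \<alpha> by (simp add: c_def)
  have bound: "norm (?f v w) \<le> (A * trunc_gauss \<alpha> R v) * (exp (c * norm w) * gauss \<alpha> w)" for v w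
  proof (cases "v \<in> ball 0 R")
    case False
    then show ?thesis by (simp add: trunc_gauss_def)
  next
    case True
    then have v: "norm v \<le> R" by simp
    have K: "norm (K_ph \<alpha> v x) \<le> 3 * exp (R * norm x / \<alpha>)" for x
    proof -
      have "exp (norm v * norm x / \<alpha>) \<le> exp (R * norm x / \<alpha>)"
        using v \<alpha> by (simp add: divide_right_mono mult_right_mono)
      then show ?thesis
        using norm_K_ph_le_exp_norm[of v x] by linarith
    qed
    have "norm (K_ph \<alpha> v w) * norm (K_ph \<alpha> v z) * norm (K_ph \<alpha> w z)
        \<le> (3 * exp (R * norm w / \<alpha>)) * (3 * exp (R * norm z / \<alpha>)) * (3 * exp (norm w * norm z / \<alpha>))"
      by (intro mult_mono K norm_K_ph_le_exp_norm) auto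
    also have "\<dots> = A * exp (c * norm w)"
      by (simp add: A_def c_def exp_add[symmetric] add_divide_distrib algebra_simps)
    finally have "norm (K_ph \<alpha> v w) * norm (K_ph \<alpha> v z) * norm (K_ph \<alpha> w z) \<le> A * exp (c * norm w)" .
    then have "trunc_gauss \<alpha> R v * gauss \<alpha> w * (norm (K_ph \<alpha> v w) * norm (K_ph \<alpha> v z) * norm (K_ph \<alpha> w z))
        \<le> trunc_gauss \<alpha> R v * gauss \<alpha> w * (A * exp (c * norm w))"
      by (intro mult_left_mono) auto
    then show ?thesis
      by (simp add: norm_mult mult_ac)
  qed
  have int: "integrable (lborel \<Otimes>\<^sub>M \<mu>) (case_prod ?f)"
  proof (rule Bochner_Integration.integrable_bound)
    show "integrable (lborel \<Otimes>\<^sub>M \<mu>)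
        (\<lambda>(v, w). (A * trunc_gauss \<alpha> R (v :: complex^'n)) * (exp (c * norm w) * gauss \<alpha> w))"
    proof (rule pair.Fubini_integrable)
      show "AE v in lborel. integrable \<mu> (\<lambda>w. case (v, w) of (v, w) \<Rightarrow>
          (A * trunc_gauss \<alpha> R v) * (exp (c * norm w) * gauss \<alpha> w))"
        using integrable_exp_norm_\<mu>[OF c] by simp
      have "A \<ge> 0" by (simp add: A_def)
      then show "integrable lborel (\<lambda>v::complex^'n. LINT w|\<mu>. norm (case (v, w) of (v, w) \<Rightarrow>
          (A * trunc_gauss \<alpha> R v) * (exp (c * norm w) * gauss \<alpha> w)))"
        using integrable_trunc_gauss[OF \<alpha>, where 'a = "complex^'n"] by (simp add: abs_mult)
    qed measurable
    show "AE x in lborel \<Otimes>\<^sub>M \<mu>. norm (case_prod ?f x) \<le>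
        norm (case x of (v, w) \<Rightarrow> (A * trunc_gauss \<alpha> R v) * (exp (c * norm w) * gauss \<alpha> w))"
      using bound by (intro AE_I2) (auto simp del: norm_mult intro: order_trans[OF _ abs_ge_self])
  qed measurable
  have "(LINT v|lborel. LINT w|\<mu>. ?f v w) = (LINT w|\<mu>. LINT v|lborel. ?f v w)"
    by (rule pair.Fubini_integral[OF int, symmetric])
  moreover have "(LINT w|\<mu>. ?f v w) =
      of_real (trunc_gauss \<alpha> R v) * (toeplitz \<alpha> \<mu> (\<lambda>w. K_ph \<alpha> w z) v * K_ph \<alpha> v z)" for v
  proof -
    have "?f v w = (of_real (trunc_gauss \<alpha> R v) * K_ph \<alpha> v z) *
        (K_ph \<alpha> v w * K_ph \<alpha> w z * of_real (exp (- (norm w)\<^sup>2 / \<alpha>)))" for w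
      by (simp add: gauss_def mult_ac)
    then have "(LINT w|\<mu>. ?f v w) = (of_real (trunc_gauss \<alpha> R v) * K_ph \<alpha> v z) *
        toeplitz \<alpha> \<mu> (\<lambda>w. K_ph \<alpha> w z) v"
      by (simp only: toeplitz_def integral_mult_right_zero)
    then show ?thesis
      by (simp only: mult_ac)
  qed
  ultimately show ?thesis
    by simp
qed

text \<open>Both sides of the truncated Fubini identity converge, for different reasons: the left
  one because its full integrand is integrable, the right one because the truncated inner products
  of kernels are bounded uniformly in the radius.\<close>

lemma toeplitz_kernel_inner:
  fixes z :: "complex^'n"
  assumes int: "integrable lborel
      (\<lambda>v. of_real (gauss \<alpha> v) * (toeplitz \<alpha> \<mu> (\<lambda>w. K_ph \<alpha> w z) v * K_ph \<alpha> v z))"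
    and meas [measurable]: "toeplitz \<alpha> \<mu> (\<lambda>w. K_ph \<alpha> w z) \<in> borel_measurable borel"
  shows "(LINT v|lborel. of_real (gauss \<alpha> v) * (toeplitz \<alpha> \<mu> (\<lambda>w. K_ph \<alpha> w z) v * K_ph \<alpha> v z))
    = of_real (gauss_total TYPE(complex^'n) \<alpha> * berezin z)"
proof (rule LIMSEQ_unique)
  let ?G = "\<lambda>N w. LINT v|lborel. of_real (trunc_gauss \<alpha> (real N) v) * (K_ph \<alpha> v w * K_ph \<alpha> v z)"
  let ?c = "gauss_total TYPE(complex^'n) \<alpha>"
  show "(\<lambda>N. LINT v|lborel. of_real (trunc_gauss \<alpha> (real N) v) *
        (toeplitz \<alpha> \<mu> (\<lambda>w. K_ph \<alpha> w z) v * K_ph \<alpha> v z))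
      \<longlonglongrightarrow> (LINT v|lborel. of_real (gauss \<alpha> v) * (toeplitz \<alpha> \<mu> (\<lambda>w. K_ph \<alpha> w z) v * K_ph \<alpha> v z))"
    by (rule trunc_integral_tendsto[OF \<alpha> int]) measurable
  have "(\<lambda>N. LINT w|\<mu>. ?G N w * K_ph \<alpha> w z * of_real (gauss \<alpha> w)) \<longlonglongrightarrow>
      (LINT w|\<mu>. (of_real ?c * K_ph \<alpha> w z) * K_ph \<alpha> w z * of_real (gauss \<alpha> w))"
  proof (rule integral_dominated_convergence)
    \<comment> \<open>The truncated inner product and the remaining kernel each contribute a factor
      3 and an exponential of \<open>norm w * norm z / \<alpha>\<close>.\<close>
    show "integrable \<mu> (\<lambda>w. (9 * ?c) * (exp ((2 * norm z / \<alpha>) * norm w) * gauss \<alpha> w))"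
      using \<alpha> by (intro integrable_mult_right integrable_exp_norm_\<mu>) simp
    show "AE w in \<mu>. (\<lambda>N. ?G N w * K_ph \<alpha> w z * of_real (gauss \<alpha> w)) \<longlonglongrightarrow>
        (of_real ?c * K_ph \<alpha> w z) * K_ph \<alpha> w z * of_real (gauss \<alpha> w)"
    proof (intro AE_I2 tendsto_mult tendsto_const)
      fix w
      show "(\<lambda>N. ?G N w) \<longlonglongrightarrow> of_real ?c * K_ph \<alpha> w z"
        unfolding integral_K_ph_mult_gauss[OF \<alpha>, symmetric]
        by (rule trunc_integral_tendsto[OF \<alpha> integrable_K_ph_mult[OF \<alpha>]]) measurable
    qed
    show "AE w in \<mu>. norm (?G N w * K_ph \<alpha> w z * of_real (gauss \<alpha> w))
        \<le> (9 * ?c) * (exp ((2 * norm z / \<alpha>) * norm w) * gauss \<alpha> w)" for N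
    proof (intro AE_I2)
      fix w
      have "norm (?G N w) * norm (K_ph \<alpha> w z)
          \<le> (3 * ?c * exp (norm w * norm z / \<alpha>)) * (3 * exp (norm w * norm z / \<alpha>))"
        using gauss_total_pos[OF \<alpha>, where 'a = "complex^'n"]
        by (intro mult_mono norm_trunc_K_ph_mult_le[OF \<alpha>] norm_K_ph_le_exp_norm) auto
      also have "\<dots> = (9 * ?c) * exp ((2 * norm z / \<alpha>) * norm w)"
        by (simp add: mult_exp_exp algebra_simps)
      finally have "norm (?G N w) * norm (K_ph \<alpha> w z) * gauss \<alpha> w
          \<le> (9 * ?c) * exp ((2 * norm z / \<alpha>) * norm w) * gauss \<alpha> w"
        by (intro mult_right_mono) auto
      then show "norm (?G N w * K_ph \<alpha> w z * of_real (gauss \<alpha> w))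
          \<le> (9 * ?c) * (exp ((2 * norm z / \<alpha>) * norm w) * gauss \<alpha> w)"
        by (simp add: norm_mult mult.assoc)
    qed
  qed measurable
  also have "(LINT w|\<mu>. (of_real ?c * K_ph \<alpha> w z) * K_ph \<alpha> w z * of_real (gauss \<alpha> w)) =
      (LINT w|\<mu>. of_real ?c * of_real ((norm (K_ph \<alpha> z w))\<^sup>2 * gauss \<alpha> w))"
  proof (rule Bochner_Integration.integral_cong[OF refl])
    fix w
    have "K_ph \<alpha> w z * K_ph \<alpha> w z = of_real ((norm (K_ph \<alpha> z w))\<^sup>2)"
      using complex_norm_square[of "K_ph \<alpha> z w"] by (simp add: K_ph_commute[of \<alpha> w z])
    then show "(of_real ?c * K_ph \<alpha> w z) * K_ph \<alpha> w z * of_real (gauss \<alpha> w) =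
        of_real ?c * of_real ((norm (K_ph \<alpha> z w))\<^sup>2 * gauss \<alpha> w)"
      by (simp add: mult.assoc)
  qed
  also have "\<dots> = of_real (?c * berezin z)"
    by (subst integral_mult_right_zero, subst integral_complex_of_real) (simp only: berezin_def of_real_mult)
  finally show "(\<lambda>N. LINT v|lborel. of_real (trunc_gauss \<alpha> (real N) v) *
        (toeplitz \<alpha> \<mu> (\<lambda>w. K_ph \<alpha> w z) v * K_ph \<alpha> v z)) \<longlonglongrightarrow> of_real (?c * berezin z)"
    by (simp only: integral_trunc_toeplitz of_nat_0_le_iff)
qed

end

section \<open>The weighted space\<close>

definition fock_measure :: "real \<Rightarrow> (complex^'n::finite) measure" where
  "fock_measure \<alpha> = density lborel (\<lambda>v. ennreal (gauss \<alpha> v / (\<alpha> * pi) ^ CARD('n)))"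

lemma sets_fock_measure [simp, measurable_cong]: "sets (fock_measure \<alpha>) = sets borel"
  by (simp add: fock_measure_def)

text \<open>An equality of functions, not only on \<open>PH2\<close>, so that it can be rewritten
  inside the definition of the Schatten class. For integrands that are not measurable both integrals
  take the default value 0.\<close>

lemma ph_inner_eq_l2_inner:
  assumes "\<alpha> > 0"
  shows "(ph_inner \<alpha> :: (complex^'n::finite \<Rightarrow> complex) \<Rightarrow> _) = l2_inner (fock_measure \<alpha>)"
proof (intro ext)
  fix f g :: "complex^'n \<Rightarrow> complex"
  let ?C = "1 / (\<alpha> * pi) ^ CARD('n)"
  let ?F = "\<lambda>v. f v * cnj (g v)"
  show "ph_inner \<alpha> f g = l2_inner (fock_measure \<alpha>) f g"
  proof (cases "?F \<in> borel_measurable borel")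
    case True
    then have "l2_inner (fock_measure \<alpha>) f g
        = (LINT v|lborel. (gauss \<alpha> v / (\<alpha> * pi) ^ CARD('n)) *\<^sub>R ?F v)"
      unfolding l2_inner_def fock_measure_def using assms by (intro integral_density) auto
    also have "\<dots> = (LINT v|lborel. of_real ?C * (?F v * of_real (exp (- (norm v)\<^sup>2 / \<alpha>))))"
      by (intro Bochner_Integration.integral_cong refl)
         (simp add: scaleR_conv_of_real gauss_def mult_ac)
    finally show ?thesis
      by (simp only: ph_inner_def integral_mult_right_zero)
  next
    case False
    \<comment> \<open>Dividing by the positive weight would give back measurability of the
      unweighted product.\<close>
    have "\<not> integrable lborel (\<lambda>v. ?F v * of_real (exp (- (norm v)\<^sup>2 / \<alpha>)))"
    proof
      assume "integrable lborel (\<lambda>v. ?F v * of_real (exp (- (norm v)\<^sup>2 / \<alpha>)))"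
      then have [measurable]: "(\<lambda>v. ?F v * of_real (exp (- (norm v)\<^sup>2 / \<alpha>))) \<in> borel_measurable borel"
        by simp
      have "(\<lambda>v. ?F v * of_real (exp (- (norm v)\<^sup>2 / \<alpha>)) / of_real (gauss \<alpha> v)) \<in> borel_measurable borel"
        by measurable
      then show False
        using False by (simp add: gauss_def)
    qed
    moreover have "\<not> integrable (fock_measure \<alpha>) ?F"
      using False by (auto dest!: borel_measurable_integrable)
    ultimately show ?thesis
      by (simp add: ph_inner_def l2_inner_def not_integrable_integral_eq)
  qed
qed

lemma nn_integral_fock_measure:
  fixes F :: "complex^'n::finite \<Rightarrow> ennreal"
  assumes "F \<in> borel_measurable borel"
  shows "(\<integral>\<^sup>+v. F v \<partial>fock_measure \<alpha>)
      = (\<integral>\<^sup>+v. ennreal (gauss \<alpha> v / (\<alpha> * pi) ^ CARD('n)) * F v \<partial>lborel)"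
  unfolding fock_measure_def using assms by (intro nn_integral_density) auto

lemma PH2_subset_l2:
  assumes "\<alpha> > 0"
  shows "PH2 \<alpha> \<subseteq> l2_space (fock_measure \<alpha> :: (complex^'n::finite) measure)"
proof
  fix f :: "complex^'n \<Rightarrow> complex" assume f: "f \<in> PH2 \<alpha>"
  then have [measurable]: "f \<in> borel_measurable borel"
    by (rule PH2_measurable)
  have "integrable lborel (\<lambda>v. (1 / (\<alpha> * pi) ^ CARD('n)) * ((norm (f v))\<^sup>2 * exp (- (norm v)\<^sup>2 / \<alpha>)))"
    using f by (intro integrable_mult_right) (simp add: PH2_def)
  then have "integrable (fock_measure \<alpha>) (\<lambda>v. (norm (f v))\<^sup>2)"
    unfolding fock_measure_def using assms
    by (subst integrable_density) (auto simp: gauss_def mult_ac)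
  then show "f \<in> l2_space (fock_measure \<alpha>)"
    by (simp add: l2_space_def measurable_cong_sets[OF sets_fock_measure refl])
qed

lemma l2_fock_measurable:
  "f \<in> l2_space (fock_measure \<alpha>) \<Longrightarrow> f \<in> borel_measurable borel"
  by (simp add: l2_space_def measurable_cong_sets[OF sets_fock_measure refl])

lemma integral_fock_measure:
  fixes F :: "complex^'n::finite \<Rightarrow> complex"
  assumes "\<alpha> > 0" "F \<in> borel_measurable borel"
  shows "integrable (fock_measure \<alpha>) F \<Longrightarrow> integrable lborel (\<lambda>v. of_real (gauss \<alpha> v) * F v)"
    and "(LINT v|fock_measure \<alpha>. F v) =
      of_real (1 / (\<alpha> * pi) ^ CARD('n)) * (LINT v|lborel. of_real (gauss \<alpha> v) * F v)"
proof -
  have eq: "(gauss \<alpha> v / (\<alpha> * pi) ^ CARD('n)) *\<^sub>R F v =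
      of_real (1 / (\<alpha> * pi) ^ CARD('n)) * (of_real (gauss \<alpha> v) * F v)" for v
    by (simp add: scaleR_conv_of_real)
  show "integrable lborel (\<lambda>v. of_real (gauss \<alpha> v) * F v)" if "integrable (fock_measure \<alpha>) F"
  proof -
    have "integrable lborel (\<lambda>v. (gauss \<alpha> v / (\<alpha> * pi) ^ CARD('n)) *\<^sub>R F v)"
      using that assms unfolding fock_measure_def by (subst (asm) integrable_density) auto
    then have "integrable lborel (\<lambda>v. of_real ((\<alpha> * pi) ^ CARD('n)) *
        ((gauss \<alpha> v / (\<alpha> * pi) ^ CARD('n)) *\<^sub>R F v))"
      by (rule integrable_mult_right)
    then show ?thesis
      using assms by (simp add: scaleR_conv_of_real)
  qed
  have "(LINT v|fock_measure \<alpha>. F v) = (LINT v|lborel. (gauss \<alpha> v / (\<alpha> * pi) ^ CARD('n)) *\<^sub>R F v)"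
    unfolding fock_measure_def using assms by (intro integral_density) auto
  then show "(LINT v|fock_measure \<alpha>. F v) =
      of_real (1 / (\<alpha> * pi) ^ CARD('n)) * (LINT v|lborel. of_real (gauss \<alpha> v) * F v)"
    unfolding eq by (simp only: integral_mult_right_zero)
qed

section \<open>Off-diagonal decay of the normalised kernel, and smoothing\<close>

lemma gauss_double_square: "(gauss (2 * \<beta>) v)\<^sup>2 = gauss \<beta> v"
  by (simp add: gauss_def exp_double[symmetric])

lemma norm_K_ph_gauss_le:
  fixes w y z :: "complex^'n::finite"
  assumes "\<alpha> > 0" "norm (y - z) \<le> 1"
  shows "norm (K_ph \<alpha> w y) * gauss (2 * \<alpha>) w * gauss (2 * \<alpha>) y
      \<le> 3 * exp (1 / (4 * \<alpha>)) * gauss (8 * \<alpha>) (w - z)"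
proof -
  define S where "S = - ((norm w)\<^sup>2 + (norm y)\<^sup>2) / 2"
  have wz: "(norm (w - z))\<^sup>2 \<le> 2 * (norm (w - y))\<^sup>2 + 2"
  proof -
    have "(norm (w - z))\<^sup>2 \<le> (norm (w - y) + norm (y - z))\<^sup>2"
      using norm_triangle_ineq[of "w - y" "y - z"] by (intro power_mono) auto
    also have "\<dots> \<le> (norm (w - y) + 1)\<^sup>2"
      using assms by (intro power_mono) auto
    also have "\<dots> \<le> 2 * (norm (w - y))\<^sup>2 + 2"
      using sum_squares_bound[of "norm (w - y)" 1] by (simp add: power2_sum)
    finally show ?thesis .
  qed
  have expand: "(norm (w - y))\<^sup>2 = (norm w)\<^sup>2 + (norm y)\<^sup>2 - 2 * (w \<bullet> y)"
    "0 \<le> (norm w)\<^sup>2 + (norm y)\<^sup>2 + 2 * (w \<bullet> y)"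
    using zero_le_power2[of "norm (w + y)"]
    by (simp_all add: power2_norm_eq_inner inner_simps inner_commute)
  \<comment> \<open>Both exponents are at most -|w-y|^2 / 4: the one of the exponential term equals
    -|w-y|^2 / 2, and the one of the constant term obeys the bound because |w-y|^2 is at most 2
    (|w|^2 + |y|^2). Replacing \<open>y\<close> by \<open>z\<close> via \<open>wz\<close> then gives
    \<open>E\<close>, hence the scale \<open>8 * \<alpha>\<close>.\<close>
  define E where "E = 1 / 4 - (norm (w - z))\<^sup>2 / 8"
  have "2 * (w \<bullet> y) \<le> (norm w)\<^sup>2 + (norm y)\<^sup>2"
    using expand zero_le_power2[of "norm (w - y)"] by simp
  then have "w \<bullet> y + S \<le> E" "S \<le> E"
    using wz expand unfolding S_def E_def by (simp_all add: field_simps)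
  then have le: "exp ((w \<bullet> y + S) / \<alpha>) \<le> exp (E / \<alpha>)" "exp (S / \<alpha>) \<le> exp (E / \<alpha>)"
    using assms by (simp_all add: divide_right_mono)
  have S: "gauss (2 * \<alpha>) w * gauss (2 * \<alpha>) y = exp (S / \<alpha>)"
    using assms by (simp add: gauss_def exp_add[symmetric] S_def field_simps)
  have "norm (K_ph \<alpha> w y) * (gauss (2 * \<alpha>) w * gauss (2 * \<alpha>) y) \<le> (2 * exp (w \<bullet> y / \<alpha>) + 1) * exp (S / \<alpha>)"
    unfolding S by (intro mult_right_mono norm_K_ph_le) simp
  also have "\<dots> = 2 * exp ((w \<bullet> y + S) / \<alpha>) + exp (S / \<alpha>)"
    by (simp add: algebra_simps add_divide_distrib exp_add)
  also have "\<dots> \<le> 3 * exp (E / \<alpha>)"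
    using le by linarith
  also have "exp (E / \<alpha>) = exp (1 / (4 * \<alpha>)) * gauss (8 * \<alpha>) (w - z)"
    using assms by (simp add: gauss_def exp_add[symmetric] E_def field_simps)
  finally show ?thesis
    by (simp add: mult.assoc)
qed

text \<open>The convolution of the weighted density of |f|^2 with a wider Gaussian. Its total
  integral is a constant times the squared norm of \<open>f\<close>, whatever \<open>f\<close>
  is.\<close>

definition smoothed :: "real \<Rightarrow> (complex^'n::finite \<Rightarrow> complex) \<Rightarrow> complex^'n \<Rightarrow> ennreal" where
  "smoothed \<alpha> f z = (\<integral>\<^sup>+w. ennreal (gauss (8 * \<alpha>) (w - z)) *
     (ennreal (gauss \<alpha> w / (\<alpha> * pi) ^ CARD('n)) * ennreal ((norm (f w))\<^sup>2)) \<partial>lborel)"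

lemma smoothed_measurable [measurable]:
  assumes [measurable]: "f \<in> borel_measurable borel"
  shows "smoothed \<alpha> f \<in> borel_measurable borel"
  unfolding smoothed_def[abs_def] by measurable

lemma nn_integral_gauss_shift:
  fixes w :: "'a::euclidean_space"
  assumes "\<beta> > 0"
  shows "(\<integral>\<^sup>+z. ennreal (gauss \<beta> (w - z)) \<partial>lborel) = ennreal (gauss_total TYPE('a) \<beta>)"
    and "(\<integral>\<^sup>+z. ennreal (gauss \<beta> (z - w)) \<partial>lborel) = ennreal (gauss_total TYPE('a) \<beta>)"
proof -
  have "(\<integral>\<^sup>+z. ennreal (gauss \<beta> (- w + z)) \<partial>lborel) = (\<integral>\<^sup>+z. ennreal (gauss \<beta> (z::'a)) \<partial>lborel)"
    by (rule lborel_nn_integral_translate) measurable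
  also have "\<dots> = ennreal (gauss_total TYPE('a) \<beta>)"
    unfolding gauss_total_def by (intro nn_integral_eq_integral integrable_gauss assms) auto
  finally show 1: "(\<integral>\<^sup>+z. ennreal (gauss \<beta> (z - w)) \<partial>lborel) = ennreal (gauss_total TYPE('a) \<beta>)"
    by simp
  have "gauss \<beta> (w - z) = gauss \<beta> (z - w)" for z
    by (simp add: gauss_def norm_minus_commute)
  with 1 show "(\<integral>\<^sup>+z. ennreal (gauss \<beta> (w - z)) \<partial>lborel) = ennreal (gauss_total TYPE('a) \<beta>)"
    by simp
qed

lemma nn_integral_smoothed:
  fixes f :: "complex^'n::finite \<Rightarrow> complex"
  assumes \<alpha>: "\<alpha> > 0" and f: "f \<in> l2_space (fock_measure \<alpha>)"
  shows "(\<integral>\<^sup>+z. smoothed \<alpha> f z \<partial>lborel) =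
    ennreal (gauss_total TYPE(complex^'n) (8 * \<alpha>)) * ennreal (Re (l2_inner (fock_measure \<alpha>) f f))"
proof -
  have [measurable]: "f \<in> borel_measurable borel"
    using f by (rule l2_fock_measurable)
  let ?F = "\<lambda>w. ennreal (gauss \<alpha> w / (\<alpha> * pi) ^ CARD('n)) * ennreal ((norm (f w))\<^sup>2)"
  let ?G = "ennreal (gauss_total TYPE(complex^'n) (8 * \<alpha>))"
  have "(\<integral>\<^sup>+z. smoothed \<alpha> f z \<partial>lborel) =
      (\<integral>\<^sup>+w. \<integral>\<^sup>+z. ennreal (gauss (8 * \<alpha>) (w - z)) * ?F w \<partial>lborel \<partial>lborel)"
    unfolding smoothed_def by (rule lborel_pair.Fubini') measurable
  also have "\<dots> = (\<integral>\<^sup>+w. ?G * ?F w \<partial>lborel)"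
  proof (rule nn_integral_cong)
    fix w
    have "(\<integral>\<^sup>+z. ennreal (gauss (8 * \<alpha>) (w - z)) * ?F w \<partial>lborel)
        = (\<integral>\<^sup>+z. ennreal (gauss (8 * \<alpha>) (w - z)) \<partial>lborel) * ?F w"
      by (rule nn_integral_multc) measurable
    then show "(\<integral>\<^sup>+z. ennreal (gauss (8 * \<alpha>) (w - z)) * ?F w \<partial>lborel) = ?G * ?F w"
      using \<alpha> by (simp only: nn_integral_gauss_shift(1))
  qed
  also have "\<dots> = ?G * (\<integral>\<^sup>+w. ?F w \<partial>lborel)"
    by (rule nn_integral_cmult) measurable
  also have "(\<integral>\<^sup>+w. ?F w \<partial>lborel) = (\<integral>\<^sup>+w. ennreal ((norm (f w))\<^sup>2) \<partial>fock_measure \<alpha>)"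
    by (rule nn_integral_fock_measure[symmetric]) measurable
  also have "\<dots> = ennreal (Re (l2_inner (fock_measure \<alpha>) f f))"
    unfolding Re_l2_inner_self using f by (intro nn_integral_eq_integral) (auto simp: l2_space_def)
  finally show ?thesis .
qed

text \<open>Schur's test for the kernel operator, with the evaluation point displaced by at most 1.\<close>

lemma l2_inner_kernel_le_smoothed:
  fixes f :: "complex^'n::finite \<Rightarrow> complex"
  assumes \<alpha>: "\<alpha> > 0"
  obtains D where "\<And>f y z. f \<in> l2_space (fock_measure \<alpha>) \<Longrightarrow> norm (y - z) \<le> 1 \<Longrightarrow>
    ennreal ((norm (l2_inner (fock_measure \<alpha>) (\<lambda>v. K_ph \<alpha> v y) f))\<^sup>2 * gauss \<alpha> (y :: complex^'n))
      \<le> ennreal D * smoothed \<alpha> f z" "D \<ge> 0"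
proof -
  define c where "c = 3 * exp (1 / (4 * \<alpha>))"
  define C where "C = 1 / (\<alpha> * pi) ^ CARD('n)"
  define D where "D = C * c\<^sup>2 * gauss_total TYPE(complex^'n) (8 * \<alpha>)"
  have C: "C \<ge> 0" using \<alpha> by (simp add: C_def)
  have bound: "ennreal ((norm (l2_inner (fock_measure \<alpha>) (\<lambda>v. K_ph \<alpha> v y) f))\<^sup>2 * gauss \<alpha> y)
      \<le> ennreal D * smoothed \<alpha> f z"
    if f: "f \<in> l2_space (fock_measure \<alpha>)" and yz: "norm (y - z) \<le> 1"
    for f and y z :: "complex^'n"
  proof -
    have [measurable]: "f \<in> borel_measurable borel"
      using f by (rule l2_fock_measurable)
    let ?I = "l2_inner (fock_measure \<alpha>) (\<lambda>v. K_ph \<alpha> v y) f"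
    \<comment> \<open>\<open>q\<close> is the square root of the smoothing weight, so that the decay
      of the kernel is shared equally by the two factors of the Cauchy-Schwarz inequality. In the
      factor without \<open>f\<close>, the density of the measure cancels the square of
      \<open>gauss (2 * \<alpha>) w\<close>, and a pure Gaussian in \<open>w - z\<close>
      remains.\<close>
    define q where "q w = gauss (16 * \<alpha>) (w - z)" for w
    have q2: "(q w)\<^sup>2 = gauss (8 * \<alpha>) (w - z)" for w
      using gauss_double_square[of "8 * \<alpha>"] by (simp add: q_def)
    have [measurable]: "q \<in> borel_measurable borel"
      unfolding q_def[abs_def] by measurable
    have q [simp]: "q w \<ge> 0" for w by (simp add: q_def)
    have K: "(\<lambda>v. K_ph \<alpha> v y) \<in> l2_space (fock_measure \<alpha>)"
      using K_ph_in_PH2[OF \<alpha>] PH2_subset_l2[OF \<alpha>] by blast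
    have "ennreal (norm ?I) \<le> (\<integral>\<^sup>+w. ennreal (norm (K_ph \<alpha> w y * cnj (f w))) \<partial>fock_measure \<alpha>)"
      unfolding l2_inner_def by (rule integral_norm_bound_ennreal[OF integrable_l2_mult[OF K f]])
    then have "ennreal (norm ?I) * ennreal (gauss (2 * \<alpha>) y) \<le>
        (\<integral>\<^sup>+w. ennreal (norm (K_ph \<alpha> w y * cnj (f w))) \<partial>fock_measure \<alpha>) * ennreal (gauss (2 * \<alpha>) y)"
      by (rule mult_right_mono) simp
    also have "\<dots> = (\<integral>\<^sup>+w. ennreal (norm (K_ph \<alpha> w y * cnj (f w))) * ennreal (gauss (2 * \<alpha>) y) \<partial>fock_measure \<alpha>)"
      by (rule nn_integral_multc[symmetric]) measurable
    also have "\<dots> \<le> (\<integral>\<^sup>+w. ennreal (c * q w / gauss (2 * \<alpha>) w) * ennreal (q w * norm (f w)) \<partial>fock_measure \<alpha>)"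
    proof (rule nn_integral_mono)
      fix w
      have "norm (K_ph \<alpha> w y) * gauss (2 * \<alpha>) y \<le> c * (q w)\<^sup>2 / gauss (2 * \<alpha>) w"
        using norm_K_ph_gauss_le[OF \<alpha> yz, of w] by (simp add: c_def q2 pos_le_divide_eq mult_ac)
      then have "norm (K_ph \<alpha> w y) * gauss (2 * \<alpha>) y * norm (f w)
          \<le> c * (q w)\<^sup>2 / gauss (2 * \<alpha>) w * norm (f w)"
        by (rule mult_right_mono) simp
      then show "ennreal (norm (K_ph \<alpha> w y * cnj (f w))) * ennreal (gauss (2 * \<alpha>) y)
          \<le> ennreal (c * q w / gauss (2 * \<alpha>) w) * ennreal (q w * norm (f w))"
        by (simp add: c_def ennreal_mult[symmetric] norm_mult power2_eq_square mult_ac)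
    qed
    finally have "(ennreal (norm ?I) * ennreal (gauss (2 * \<alpha>) y))\<^sup>2 \<le>
        (\<integral>\<^sup>+w. ennreal (c * q w / gauss (2 * \<alpha>) w) * ennreal (q w * norm (f w)) \<partial>fock_measure \<alpha>)\<^sup>2"
      by (rule power_mono) simp
    also have "\<dots> \<le> (\<integral>\<^sup>+w. (ennreal (c * q w / gauss (2 * \<alpha>) w))\<^sup>2 \<partial>fock_measure \<alpha>) *
        (\<integral>\<^sup>+w. (ennreal (q w * norm (f w)))\<^sup>2 \<partial>fock_measure \<alpha>)"
      by (rule Cauchy_Schwarz_nn_integral) measurable
    also have "(\<integral>\<^sup>+w. (ennreal (q w * norm (f w)))\<^sup>2 \<partial>fock_measure \<alpha>) = smoothed \<alpha> f z"
      unfolding smoothed_def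
      by (subst nn_integral_fock_measure, measurable, rule nn_integral_cong)
         (use \<alpha> in \<open>simp add: q2 ennreal_power ennreal_mult[symmetric] power_mult_distrib mult_ac\<close>)
    also have "(\<integral>\<^sup>+w. (ennreal (c * q w / gauss (2 * \<alpha>) w))\<^sup>2 \<partial>fock_measure \<alpha>)
        = (\<integral>\<^sup>+w. ennreal (C * c\<^sup>2) * ennreal (gauss (8 * \<alpha>) (w - z)) \<partial>lborel)"
    proof (subst nn_integral_fock_measure, measurable, rule nn_integral_cong)
      fix w
      have "gauss \<alpha> w / (\<alpha> * pi) ^ CARD('n) * (c * q w / gauss (2 * \<alpha>) w)\<^sup>2 = C * c\<^sup>2 * gauss (8 * \<alpha>) (w - z)"
        by (simp add: power_divide power_mult_distrib q2 gauss_double_square C_def less_imp_neq[OF gauss_pos, symmetric])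
      then show "ennreal (gauss \<alpha> w / (\<alpha> * pi) ^ CARD('n)) * (ennreal (c * q w / gauss (2 * \<alpha>) w))\<^sup>2
          = ennreal (C * c\<^sup>2) * ennreal (gauss (8 * \<alpha>) (w - z))"
        using \<alpha> C by (simp add: ennreal_power c_def ennreal_mult[symmetric])
    qed
    also have "\<dots> = ennreal (C * c\<^sup>2) * ennreal (gauss_total TYPE(complex^'n) (8 * \<alpha>))"
      by (subst nn_integral_cmult, measurable) (use \<alpha> in \<open>simp add: nn_integral_gauss_shift\<close>)
    also have "\<dots> = ennreal D"
      using C by (simp add: D_def ennreal_mult')
    finally show ?thesis
      by (simp add: ennreal_mult[symmetric] ennreal_power power_mult_distrib gauss_double_square)
  qed
  show thesis
    by (rule that[of D, OF bound])
       (use C gauss_total_pos[of "8 * \<alpha>", where 'a = "complex^'n"] \<alpha> in \<open>auto simp: D_def\<close>)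
qed

section \<open>Lower bounds for the kernel near the diagonal\<close>

text \<open>The condition \<open>x \<bullet> w \<ge> \<alpha>\<close> makes the exponential at least
  2, so the summand -1 costs at most half of the oscillating term. The two weights then complete the
  square.\<close>

lemma kernel_sq_ge:
  fixes x w :: "complex^'n::finite"
  assumes \<alpha>: "\<alpha> > 0" and xw: "x \<bullet> w \<ge> \<alpha>" and c: "\<bar>cos (Im (herm x w) / \<alpha>)\<bar> \<ge> 1 / 2"
  shows "exp (- (norm (w - x))\<^sup>2 / \<alpha>) \<le> 4 * ((norm (K_ph \<alpha> x w))\<^sup>2 * gauss \<alpha> w * gauss \<alpha> x)"
proof -
  define E where "E = exp (x \<bullet> w / \<alpha>)"
  have "1 \<le> x \<bullet> w / \<alpha>"
    using xw \<alpha> by simp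
  then have E: "E \<ge> 2"
    using exp_ge_add_one_self[of "x \<bullet> w / \<alpha>"] unfolding E_def by linarith
  have "E * 1 \<le> 2 * E * \<bar>cos (Im (herm x w) / \<alpha>)\<bar>"
    using mult_left_mono[OF c, of "2 * E"] E by simp
  then have "E \<le> \<bar>2 * E * cos (Im (herm x w) / \<alpha>)\<bar>"
    using E by (simp add: abs_mult)
  then have "E / 2 \<le> norm (K_ph \<alpha> x w)"
    using E unfolding K_ph_real norm_of_real E_def[symmetric] by linarith
  then have "(E / 2)\<^sup>2 \<le> (norm (K_ph \<alpha> x w))\<^sup>2"
    using E by (intro power_mono) auto
  then have "E\<^sup>2 \<le> 4 * (norm (K_ph \<alpha> x w))\<^sup>2"
    by (simp add: power_divide)
  then have "E\<^sup>2 * (gauss \<alpha> w * gauss \<alpha> x) \<le> 4 * (norm (K_ph \<alpha> x w))\<^sup>2 * (gauss \<alpha> w * gauss \<alpha> x)"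
    by (rule mult_right_mono) simp
  moreover have "E\<^sup>2 * (gauss \<alpha> w * gauss \<alpha> x) = exp (- (norm (w - x))\<^sup>2 / \<alpha>)"
  proof -
    have "- (norm (w - x))\<^sup>2 = 2 * (x \<bullet> w) - (norm w)\<^sup>2 - (norm x)\<^sup>2"
      by (simp add: power2_norm_eq_inner inner_simps inner_commute)
    then have "- (norm (w - x))\<^sup>2 / \<alpha> = 2 * (x \<bullet> w / \<alpha>) + (- (norm w)\<^sup>2 / \<alpha> + - (norm x)\<^sup>2 / \<alpha>)"
      by (simp add: diff_divide_distrib)
    then show ?thesis
      by (simp only: E_def gauss_def exp_add exp_double)
  qed
  ultimately show ?thesis
    by (simp add: mult.assoc)
qed

text \<open>A quarter period turns the cosine into a sine, and an error of 1/3 in the argument is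
  harmless: if the second alternative fails, the sine of \<theta> is at most 1/2 + 1/3 = 5/6 in
  absolute value, so its squared cosine is at least 11/36, which exceeds 1/4.\<close>

lemma cos_or_shifted_cos:
  fixes \<theta> \<eta> :: real
  assumes "\<bar>\<eta>\<bar> \<le> 1 / 3"
  shows "\<bar>cos \<theta>\<bar> \<ge> 1 / 2 \<or> \<bar>cos (\<theta> + pi / 2 + \<eta>)\<bar> \<ge> 1 / 2"
proof (rule disjCI)
  assume "\<not> \<bar>cos (\<theta> + pi / 2 + \<eta>)\<bar> \<ge> 1 / 2"
  moreover have "cos (\<theta> + pi / 2 + \<eta>) = - sin (\<theta> + \<eta>)"
    using minus_sin_cos_eq[of "\<theta> + \<eta>"] by (simp add: ac_simps)
  ultimately have s: "\<bar>sin (\<theta> + \<eta>)\<bar> < 1 / 2"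
    by simp
  have "\<bar>sin \<theta> - sin (\<theta> + \<eta>)\<bar> = 2 * \<bar>sin ((- \<eta>) / 2)\<bar> * \<bar>cos ((\<theta> + (\<theta> + \<eta>)) / 2)\<bar>"
    by (subst sin_diff_sin) (simp add: abs_mult)
  also have "\<dots> \<le> 2 * \<bar>sin ((- \<eta>) / 2)\<bar> * 1"
    by (intro mult_left_mono) auto
  also have "\<dots> \<le> 2 * \<bar>(- \<eta>) / 2\<bar>"
    using abs_sin_x_le_abs_x[of "(- \<eta>) / 2"] by linarith
  finally have "\<bar>sin \<theta> - sin (\<theta> + \<eta>)\<bar> \<le> 1 / 3"
    using assms by simp
  with s have "\<bar>sin \<theta>\<bar> \<le> 5 / 6"
    by linarith
  then have "(sin \<theta>)\<^sup>2 \<le> (5 / 6)\<^sup>2"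
    by (simp add: abs_le_square_iff[symmetric])
  then have "(1 / 2)\<^sup>2 \<le> (cos \<theta>)\<^sup>2"
    using sin_cos_squared_add[of \<theta>] by (simp add: power2_eq_square)
  then show "\<bar>cos \<theta>\<bar> \<ge> 1 / 2"
    by (simp add: abs_le_square_iff[symmetric])
qed

text \<open>The factor \<open>1 + \<i>\<epsilon>\<close> with \<open>\<epsilon> = \<alpha> * pi / (2 * (norm z)\<^sup>2)\<close> shifts the phase of the kernel by
  about a quarter of a period, so the zeros near \<open>z\<close> of the kernels at the two points are disjoint.\<close>

lemma kernel_pair_lower_bound:
  fixes z :: "complex^'n::finite"
  assumes \<alpha>: "\<alpha> > 0" and r: "r > 0" and z: "norm z \<ge> 6 * r + 1 + 2 * \<alpha>"
  obtains y :: "complex^'n" where "norm (y - z) \<le> 1"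
    "\<And>w. w \<in> ball z r \<Longrightarrow> 1 \<le> 4 * exp ((r + 1)\<^sup>2 / \<alpha>) *
      ((norm (K_ph \<alpha> z w))\<^sup>2 * gauss \<alpha> w * gauss \<alpha> z + (norm (K_ph \<alpha> y w))\<^sup>2 * gauss \<alpha> w * gauss \<alpha> y)"
proof -
  have nz: "norm z > 0"
    using z \<alpha> r by linarith
  define \<epsilon> where "\<epsilon> = \<alpha> * pi / (2 * (norm z)\<^sup>2)"
  define y where "y = Complex 1 \<epsilon> *s z"
  have \<epsilon>: "\<epsilon> > 0"
    using \<alpha> nz by (simp add: \<epsilon>_def)
  have "y - z = Complex 0 \<epsilon> *s z"
    by (simp add: y_def vec_eq_iff complex_eq_iff)
  then have "norm (y - z) = \<epsilon> * norm z"
    using \<epsilon> by (simp add: norm_smult_vec cmod_def)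
  also have "\<dots> = \<alpha> * pi / (2 * norm z)"
    using nz by (simp add: \<epsilon>_def power2_eq_square)
  also have "\<dots> \<le> 1"
  proof -
    have "\<alpha> * pi \<le> \<alpha> * 4"
      using pi_less_4 \<alpha> by simp
    also have "\<dots> \<le> 2 * norm z"
      using z r by linarith
    finally show ?thesis
      using nz by simp
  qed
  finally have yz: "norm (y - z) \<le> 1" .
  show thesis
  proof (rule that[OF yz])
    fix w assume "w \<in> ball z r"
    then have wz: "norm (w - z) < r"
      by (simp add: dist_norm norm_minus_commute)
    define Q where "Q x = (norm (K_ph \<alpha> x w))\<^sup>2 * gauss \<alpha> w * gauss \<alpha> x" for x
    have Q: "1 \<le> 4 * exp ((r + 1)\<^sup>2 / \<alpha>) * Q x"
      if x: "norm (x - z) \<le> 1" and c: "\<bar>cos (Im (herm x w) / \<alpha>)\<bar> \<ge> 1 / 2" for x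
    proof -
      have "norm (w - x) \<le> r + 1"
        using norm_triangle_ineq4[of "w - z" "x - z"] wz x by simp
      then have wx: "(norm (w - x))\<^sup>2 \<le> (r + 1)\<^sup>2"
        by (intro power_mono) auto
      \<comment> \<open>Since 2 (x . w) is at least |w|^2 - |w-x|^2, it is enough that
        \<open>norm w\<close> exceeds \<open>r + 1\<close>, the bound for
        \<open>norm (w - x)\<close>, by \<open>2 * \<alpha>\<close>.\<close>
      have "norm z - norm (w - z) \<le> norm w"
        using norm_triangle_ineq2[of z "z - w"] by (simp add: norm_minus_commute)
      then have "r + 1 + 2 * \<alpha> \<le> norm w"
        using wz z r by linarith
      then have "(r + 1 + 2 * \<alpha>)\<^sup>2 \<le> (norm w)\<^sup>2"
        using r \<alpha> by (intro power_mono) auto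
      moreover have "(r + 1 + 2 * \<alpha>)\<^sup>2 = (r + 1)\<^sup>2 + 4 * \<alpha> * (r + \<alpha>) + 4 * \<alpha>"
        by (simp add: power2_eq_square algebra_simps)
      moreover have "0 \<le> \<alpha> * (r + \<alpha>)"
        using r \<alpha> by simp
      moreover have "(norm (w - x))\<^sup>2 = (norm w)\<^sup>2 + (norm x)\<^sup>2 - 2 * (x \<bullet> w)"
        by (simp add: power2_norm_eq_inner inner_simps inner_commute)
      ultimately have "x \<bullet> w \<ge> \<alpha>"
        using wx zero_le_power2[of "norm x"] \<alpha> by linarith
      then have "exp (- (norm (w - x))\<^sup>2 / \<alpha>) \<le> 4 * Q x"
        unfolding Q_def by (rule kernel_sq_ge[OF \<alpha> _ c])
      moreover have "exp (- (r + 1)\<^sup>2 / \<alpha>) \<le> exp (- (norm (w - x))\<^sup>2 / \<alpha>)"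
        using wx \<alpha> by (simp add: divide_right_mono)
      ultimately have "exp (- (r + 1)\<^sup>2 / \<alpha>) \<le> 4 * Q x"
        by linarith
      then have "exp ((r + 1)\<^sup>2 / \<alpha>) * exp (- (r + 1)\<^sup>2 / \<alpha>) \<le> exp ((r + 1)\<^sup>2 / \<alpha>) * (4 * Q x)"
        by (rule mult_left_mono) simp
      then show ?thesis
        by (simp add: mult_exp_exp mult_ac)
    qed
    have Q_nonneg: "0 \<le> 4 * exp ((r + 1)\<^sup>2 / \<alpha>) * Q x" for x
      by (simp add: Q_def)
    define \<theta> where "\<theta> = Im (herm z w) / \<alpha>"
    \<comment> \<open>The deviation of the phase shift from a quarter period, caused by
      \<open>w\<close> differing from \<open>z\<close>. It is at most 2r / |z|, which explains
      \<open>6 * r\<close> in the lower bound for \<open>norm z\<close>.\<close>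
    define \<eta> where "\<eta> = pi / 2 * (z \<bullet> (w - z)) / (norm z)\<^sup>2"
    have "\<bar>z \<bullet> (w - z)\<bar> \<le> norm z * r"
      using Cauchy_Schwarz_ineq2[of z "w - z"] wz nz
      by (meson less_imp_le mult_left_mono norm_ge_zero order_trans)
    then have "pi / 2 * \<bar>z \<bullet> (w - z)\<bar> \<le> 2 * (norm z * r)"
      using pi_less_4 by (intro mult_mono) auto
    also have "\<dots> \<le> (norm z)\<^sup>2 * (1 / 3)"
    proof -
      have "norm z * (6 * r) \<le> norm z * norm z"
        using z \<alpha> by (intro mult_left_mono) auto
      then show ?thesis
        by (simp add: power2_eq_square)
    qed
    finally have \<eta>: "\<bar>\<eta>\<bar> \<le> 1 / 3"
      using nz by (simp add: \<eta>_def abs_mult divide_le_eq mult_ac)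
    have "Im (herm y w) = Im (herm z w) + \<epsilon> * (z \<bullet> w)"
      by (simp add: y_def herm_smult_left Re_herm)
    moreover have "\<epsilon> * (z \<bullet> w) / \<alpha> = pi / 2 + \<eta>"
    proof -
      have zw: "z \<bullet> w = (norm z)\<^sup>2 + z \<bullet> (w - z)"
        by (simp add: power2_norm_eq_inner inner_diff_right)
      have "\<epsilon> * (z \<bullet> w) / \<alpha> = pi / 2 * ((z \<bullet> w) / (norm z)\<^sup>2)"
        using \<alpha> by (simp add: \<epsilon>_def)
      also have "(z \<bullet> w) / (norm z)\<^sup>2 = 1 + (z \<bullet> (w - z)) / (norm z)\<^sup>2"
        unfolding zw using nz by (simp add: add_divide_distrib)
      finally show ?thesis
        by (simp add: \<eta>_def distrib_left)
    qed
    ultimately have "Im (herm y w) / \<alpha> = \<theta> + pi / 2 + \<eta>"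
      by (simp add: \<theta>_def add_divide_distrib)
    with cos_or_shifted_cos[OF \<eta>, of \<theta>]
    have "\<bar>cos (Im (herm z w) / \<alpha>)\<bar> \<ge> 1 / 2 \<or> \<bar>cos (Im (herm y w) / \<alpha>)\<bar> \<ge> 1 / 2"
      by (simp add: \<theta>_def)
    then have "1 \<le> 4 * exp ((r + 1)\<^sup>2 / \<alpha>) * Q z \<or> 1 \<le> 4 * exp ((r + 1)\<^sup>2 / \<alpha>) * Q y"
      using Q[of z] Q[of y] yz by auto
    then have "1 \<le> 4 * exp ((r + 1)\<^sup>2 / \<alpha>) * Q z + 4 * exp ((r + 1)\<^sup>2 / \<alpha>) * Q y"
      using Q_nonneg[of z] Q_nonneg[of y] by (auto intro: add_increasing add_increasing2)
    then show "1 \<le> 4 * exp ((r + 1)\<^sup>2 / \<alpha>) *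
      ((norm (K_ph \<alpha> z w))\<^sup>2 * gauss \<alpha> w * gauss \<alpha> z + (norm (K_ph \<alpha> y w))\<^sup>2 * gauss \<alpha> w * gauss \<alpha> y)"
      by (simp only: Q_def distrib_left)
  qed
qed

section \<open>Averages of the measure\<close>

context kernel_measure
begin

text \<open>The same \<open>y\<close> works for every \<open>w\<close> in the ball, so the pointwise
  lower bound for the pair of kernels can be integrated directly.\<close>

lemma emeasure_ball_le_berezin:
  assumes r: "r > 0" and z: "norm z \<ge> 6 * r + 1 + 2 * \<alpha>"
  obtains y where "norm (y - z) \<le> 1"
    "emeasure \<mu> (ball z r) \<le> ennreal (4 * exp ((r + 1)\<^sup>2 / \<alpha>) *
      (berezin z * gauss \<alpha> z + berezin y * gauss \<alpha> y))"
proof -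
  obtain y where y: "norm (y - z) \<le> 1"
    and bound: "\<And>w. w \<in> ball z r \<Longrightarrow> 1 \<le> 4 * exp ((r + 1)\<^sup>2 / \<alpha>) *
      ((norm (K_ph \<alpha> z w))\<^sup>2 * gauss \<alpha> w * gauss \<alpha> z + (norm (K_ph \<alpha> y w))\<^sup>2 * gauss \<alpha> w * gauss \<alpha> y)"
    using kernel_pair_lower_bound[OF \<alpha> r z] by blast
  let ?F = "\<lambda>w. 4 * exp ((r + 1)\<^sup>2 / \<alpha>) *
      ((norm (K_ph \<alpha> z w))\<^sup>2 * gauss \<alpha> w * gauss \<alpha> z + (norm (K_ph \<alpha> y w))\<^sup>2 * gauss \<alpha> w * gauss \<alpha> y)"
  have int: "integrable \<mu> ?F"
    by (intro integrable_mult_right Bochner_Integration.integrable_add integrable_mult_left integrable_kernel_sq)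
  have "emeasure \<mu> (ball z r) = (\<integral>\<^sup>+w. indicator (ball z r) w \<partial>\<mu>)"
    by (simp add: sets_\<mu>)
  also have "\<dots> \<le> (\<integral>\<^sup>+w. ennreal (?F w) \<partial>\<mu>)"
    using bound by (intro nn_integral_mono) (auto simp: indicator_def)
  also have "\<dots> = ennreal (LINT w|\<mu>. ?F w)"
    by (intro nn_integral_eq_integral int) simp
  also have "(LINT w|\<mu>. ?F w) = 4 * exp ((r + 1)\<^sup>2 / \<alpha>) *
      (berezin z * gauss \<alpha> z + berezin y * gauss \<alpha> y)"
    unfolding berezin_def
    by (subst integral_mult_right_zero, subst Bochner_Integration.integral_add)
       (simp_all add: integrable_kernel_sq)
  finally show thesis
    using that[OF y] by blast
qed

text \<open>\<open>\<Phi>\<close> sees only \<open>z\<close>, while \<open>y\<close> ranges freely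
  over the unit ball around it. A later choice of \<open>y\<close> for each \<open>z\<close> thus
  raises no question of measurability.\<close>

lemma berezin_powr_dominated:
  assumes p: "p \<ge> 1" and T: "toeplitz_in_schatten \<alpha> \<mu> p"
  obtains \<Phi> :: "complex^'n \<Rightarrow> ennreal" and \<kappa> :: real where "\<kappa> > 0" "\<Phi> \<in> borel_measurable borel"
    "(\<integral>\<^sup>+z. \<Phi> z \<partial>lborel) < \<infinity>"
    "\<And>y z. norm (y - z) \<le> 1 \<Longrightarrow> ennreal ((\<kappa> * (berezin y * gauss \<alpha> y)) powr p) \<le> \<Phi> z"
proof -
  let ?M = "fock_measure \<alpha> :: (complex^'n) measure"
  let ?K = "\<lambda>y v. K_ph \<alpha> v y"
  let ?G = "gauss_total TYPE(complex^'n) (8 * \<alpha>)"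
  obtain T where T_class: "T \<in> schatten_class (PH2 \<alpha>) (l2_inner ?M) p"
    and T: "\<And>f. f \<in> kernel_span \<alpha> \<Longrightarrow> T f = toeplitz \<alpha> \<mu> f"
    using assms(2) unfolding toeplitz_in_schatten_def ph_inner_eq_l2_inner[OF \<alpha>] by blast
  obtain e u :: "nat \<Rightarrow> complex^'n \<Rightarrow> complex" and s where
    eu: "\<And>k. e k \<in> l2_space ?M" "\<And>k. u k \<in> l2_space ?M"
    and le1: "\<And>k. Re (l2_inner ?M (e k) (e k)) \<le> 1" "\<And>k. Re (l2_inner ?M (u k) (u k)) \<le> 1"
    and s: "summable (\<lambda>k::nat. s k powr p)"
    and bound: "\<And>g. g \<in> PH2 \<alpha> \<Longrightarrow> ennreal (norm (l2_inner ?M (T g) g) powr p) \<le>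
       ennreal (Re (l2_inner ?M g g) powr (p - 1)) *
       (\<Sum>k. ennreal (s k powr p) * ennreal ((norm (l2_inner ?M g (e k)))\<^sup>2 + (norm (l2_inner ?M g (u k)))\<^sup>2))"
    by (rule schatten_diagonal_bound[OF T_class PH2_subset_l2[OF \<alpha>] p], rule that)
  obtain D where D: "D \<ge> 0" and smooth: "\<And>f y z. f \<in> l2_space ?M \<Longrightarrow> norm (y - z) \<le> 1 \<Longrightarrow>
      ennreal ((norm (l2_inner ?M (?K y) f))\<^sup>2 * gauss \<alpha> y) \<le> ennreal D * smoothed \<alpha> f z"
    by (rule l2_inner_kernel_le_smoothed[OF \<alpha>]) blast
  define C where "C = 1 / (\<alpha> * pi) ^ CARD('n)"
  \<comment> \<open>The ratio of the Gaussian integral to the normalising constant of the inner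
    product, equal to 1 by the classical evaluation; here its positivity suffices.\<close>
  define \<kappa> where "\<kappa> = C * gauss_total TYPE(complex^'n) \<alpha>"
  have \<kappa>: "\<kappa> > 0"
    using \<alpha> gauss_total_pos[OF \<alpha>, where 'a = "complex^'n"] by (simp add: \<kappa>_def C_def)
  \<comment> \<open>The smoothed densities of all Schmidt vectors have uniformly bounded integrals,
    so the integral of the series is controlled by the sum of \<open>s k powr p\<close>.\<close>
  define \<Phi> where "\<Phi> z = ennreal ((2 * \<kappa>) powr (p - 1)) *
      (\<Sum>k. ennreal (s k powr p) * (ennreal D * (smoothed \<alpha> (e k) z + smoothed \<alpha> (u k) z)))" for z
  have [measurable]: "e k \<in> borel_measurable borel" "u k \<in> borel_measurable borel" for k
    using eu by (auto intro: l2_fock_measurable)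
  have \<Phi>_meas: "\<Phi> \<in> borel_measurable borel"
    unfolding \<Phi>_def[abs_def] by measurable
  have "(\<integral>\<^sup>+z. \<Phi> z \<partial>lborel) = ennreal ((2 * \<kappa>) powr (p - 1)) *
      (\<Sum>k. ennreal (s k powr p) * (ennreal D *
        ((\<integral>\<^sup>+z. smoothed \<alpha> (e k) z \<partial>lborel) + (\<integral>\<^sup>+z. smoothed \<alpha> (u k) z \<partial>lborel))))"
    unfolding \<Phi>_def by (simp add: nn_integral_cmult nn_integral_suminf nn_integral_add)
  also have "\<dots> \<le> ennreal ((2 * \<kappa>) powr (p - 1)) *
      (\<Sum>k. ennreal (s k powr p) * (ennreal D * (ennreal ?G + ennreal ?G)))"
  proof (intro mult_left_mono suminf_le add_mono summableI)
    fix k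
    have 1: "ennreal ?G * ennreal (Re (l2_inner ?M f f)) \<le> ennreal ?G" if "Re (l2_inner ?M f f) \<le> 1" for f
      using mult_left_mono[of "ennreal (Re (l2_inner ?M f f))" 1 "ennreal ?G"] that
      by (simp add: ennreal_le_1)
    show "(\<integral>\<^sup>+z. smoothed \<alpha> (e k) z \<partial>lborel) \<le> ennreal ?G"
      "(\<integral>\<^sup>+z. smoothed \<alpha> (u k) z \<partial>lborel) \<le> ennreal ?G"
      using 1 le1 by (simp_all add: nn_integral_smoothed[OF \<alpha>] eu)
  qed auto
  also have "\<dots> = ennreal ((2 * \<kappa>) powr (p - 1)) * ((\<Sum>k. ennreal (s k powr p)) * (ennreal D * (ennreal ?G + ennreal ?G)))"
    by (simp only: ennreal_suminf_multc)
  also have "(\<Sum>k. ennreal (s k powr p)) = ennreal (\<Sum>k. s k powr p)"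
    using s by (intro suminf_ennreal2) auto
  also have "ennreal ((2 * \<kappa>) powr (p - 1)) * (ennreal (\<Sum>k. s k powr p) * (ennreal D * (ennreal ?G + ennreal ?G))) < \<infinity>"
    by (simp add: ennreal_mult_less_top)
  finally have \<Phi>_fin: "(\<integral>\<^sup>+z. \<Phi> z \<partial>lborel) < \<infinity>" .
  have \<Phi>_bound: "ennreal ((\<kappa> * (berezin y * gauss \<alpha> y)) powr p) \<le> \<Phi> z" if yz: "norm (y - z) \<le> 1" for y z
  proof -
    let ?H = "toeplitz \<alpha> \<mu> (?K y)"
    have K: "?K y \<in> PH2 \<alpha>"
      by (rule K_ph_in_PH2[OF \<alpha>])
    then have K2: "?K y \<in> l2_space ?M"
      using PH2_subset_l2[OF \<alpha>] by blast
    have [measurable]: "?K y \<in> borel_measurable borel"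
      by measurable
    have TK: "T (?K y) = ?H"
      by (rule T[OF K_ph_in_kernel_span])
    have "T (?K y) \<in> PH2 \<alpha>"
      using T_class K unfolding schatten_class_def bounded_operator_on_def by auto
    then have H: "?H \<in> l2_space ?M" and H_meas [measurable]: "?H \<in> borel_measurable borel"
      using PH2_subset_l2[OF \<alpha>] PH2_measurable unfolding TK by blast+
    have "integrable ?M (\<lambda>v. ?H v * ?K y v)"
      using integrable_l2_mult[OF H K2] by simp
    then have int: "integrable lborel (\<lambda>v. of_real (gauss \<alpha> v) * (?H v * ?K y v))"
      by (rule integral_fock_measure(1)[OF \<alpha>, rotated]) measurable
    have "l2_inner ?M (T (?K y)) (?K y) = of_real C * of_real (gauss_total TYPE(complex^'n) \<alpha> * berezin y)"
      unfolding TK l2_inner_def cnj_K_ph C_def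
      by (subst integral_fock_measure(2)[OF \<alpha>], measurable, subst toeplitz_kernel_inner[OF int H_meas])
         simp_all
    also have "\<dots> = of_real (\<kappa> * berezin y)"
      by (simp add: \<kappa>_def)
    finally have norm_TK: "norm (l2_inner ?M (T (?K y)) (?K y)) = \<kappa> * berezin y"
      using \<kappa> berezin_nonneg[of y] by (simp only: norm_of_real) (simp add: abs_mult)
    have "l2_inner ?M (?K y) (?K y) = of_real C * (of_real (gauss_total TYPE(complex^'n) \<alpha>) * K_ph \<alpha> y y)"
      unfolding l2_inner_def cnj_K_ph C_def
      by (subst integral_fock_measure(2)[OF \<alpha>], measurable) (simp only: integral_K_ph_mult_gauss[OF \<alpha>])
    then have "Re (l2_inner ?M (?K y) (?K y)) = \<kappa> * Re (K_ph \<alpha> y y)"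
      by (simp add: \<kappa>_def mult.assoc[symmetric] of_real_mult[symmetric] del: of_real_mult)
    also have "\<dots> \<le> \<kappa> * (2 / gauss \<alpha> y)"
    proof (rule mult_left_mono)
      have "Im (herm y y) = 0"
        by (simp add: herm_self)
      then show "Re (K_ph \<alpha> y y) \<le> 2 / gauss \<alpha> y"
        by (simp add: K_ph_real gauss_def exp_minus power2_norm_eq_inner divide_inverse)
    qed (use \<kappa> in simp)
    finally have A: "Re (l2_inner ?M (?K y) (?K y)) powr (p - 1) \<le> (2 * \<kappa> / gauss \<alpha> y) powr (p - 1)"
      using p by (intro powr_mono2) (auto simp: mult.commute)
    let ?q = "\<lambda>k. (norm (l2_inner ?M (?K y) (e k)))\<^sup>2 + (norm (l2_inner ?M (?K y) (u k)))\<^sup>2"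
    have "ennreal ((\<kappa> * (berezin y * gauss \<alpha> y)) powr p) =
        ennreal ((\<kappa> * berezin y) powr p) * ennreal (gauss \<alpha> y powr p)"
      using \<kappa> berezin_nonneg[of y] by (simp add: mult.assoc[symmetric] powr_mult ennreal_mult)
    also have "\<dots> \<le> (ennreal ((2 * \<kappa> / gauss \<alpha> y) powr (p - 1)) *
        (\<Sum>k. ennreal (s k powr p) * ennreal (?q k))) * ennreal (gauss \<alpha> y powr p)"
      by (intro mult_right_mono zero_le
          order_trans[OF bound[OF K, unfolded norm_TK] mult_right_mono[OF ennreal_leI[OF A]]])
    also have "\<dots> = (ennreal ((2 * \<kappa> / gauss \<alpha> y) powr (p - 1)) * ennreal (gauss \<alpha> y powr p)) *
        (\<Sum>k. ennreal (s k powr p) * ennreal (?q k))"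
      by (simp only: mult_ac)
    \<comment> \<open>Of the p powers of the weight, p - 1 cancel the growth of the norm of the
      kernel. The single one left is exactly the weight that the smoothing bound for the
      coefficients requires.\<close>
    also have "ennreal ((2 * \<kappa> / gauss \<alpha> y) powr (p - 1)) * ennreal (gauss \<alpha> y powr p) =
        ennreal ((2 * \<kappa>) powr (p - 1)) * ennreal (gauss \<alpha> y)"
    proof -
      have "(2 * \<kappa> / gauss \<alpha> y) powr (p - 1) * gauss \<alpha> y powr p = (2 * \<kappa>) powr (p - 1) * gauss \<alpha> y powr (p - (p - 1))"
        using \<kappa> by (simp add: powr_divide powr_diff)
      also have "\<dots> = (2 * \<kappa>) powr (p - 1) * gauss \<alpha> y"
        by simp
      finally show ?thesis
        by (simp add: ennreal_mult[symmetric])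
    qed
    also have "ennreal ((2 * \<kappa>) powr (p - 1)) * ennreal (gauss \<alpha> y) *
        (\<Sum>k. ennreal (s k powr p) * ennreal (?q k)) =
        ennreal ((2 * \<kappa>) powr (p - 1)) * (\<Sum>k. ennreal (s k powr p) * ennreal (?q k) * ennreal (gauss \<alpha> y))"
      by (subst ennreal_suminf_multc) (simp only: mult_ac)
    also have "\<dots> \<le> \<Phi> z"
      unfolding \<Phi>_def
    proof (intro mult_left_mono suminf_le summableI)
      fix k
      have "ennreal (?q k) * ennreal (gauss \<alpha> y) =
          ennreal ((norm (l2_inner ?M (?K y) (e k)))\<^sup>2 * gauss \<alpha> y) +
          ennreal ((norm (l2_inner ?M (?K y) (u k)))\<^sup>2 * gauss \<alpha> y)"
        by (simp add: ennreal_mult[symmetric] ennreal_plus[symmetric] distrib_right del: ennreal_plus)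
      also have "\<dots> \<le> ennreal D * smoothed \<alpha> (e k) z + ennreal D * smoothed \<alpha> (u k) z"
        by (intro add_mono smooth eu yz)
      finally have "ennreal (?q k) * ennreal (gauss \<alpha> y) \<le>
          ennreal D * (smoothed \<alpha> (e k) z + smoothed \<alpha> (u k) z)"
        by (simp only: distrib_left)
      then show "ennreal (s k powr p) * ennreal (?q k) * ennreal (gauss \<alpha> y) \<le>
          ennreal (s k powr p) * (ennreal D * (smoothed \<alpha> (e k) z + smoothed \<alpha> (u k) z))"
        by (simp only: mult.assoc mult_left_mono zero_le)
    qed simp
    finally show ?thesis .
  qed
  show thesis
    by (rule that[OF \<kappa> \<Phi>_meas \<Phi>_fin \<Phi>_bound])
qed

section \<open>Measurability and the final integral estimate\<close>

text \<open>Rewritten as a parameter integral, the measure of the ball has a jointly measurable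
  integrand, and \<mu> is sigma-finite.\<close>

lemma emeasure_ball_measurable: "(\<lambda>z. emeasure \<mu> (ball z r)) \<in> borel_measurable lborel"
proof -
  have "emeasure \<mu> (ball z r) = (\<integral>\<^sup>+w. (if dist z w < r then 1 else 0) \<partial>\<mu>)" for z
  proof -
    have "emeasure \<mu> (ball z r) = (\<integral>\<^sup>+w. indicator (ball z r) w \<partial>\<mu>)"
      by (simp add: sets_\<mu>)
    then show ?thesis
      by (simp add: indicator_def of_bool_def)
  qed
  then show ?thesis
    by simp
qed

lemma in_Lp_emeasure_ball:
  assumes p: "p \<ge> 1" and T: "toeplitz_in_schatten \<alpha> \<mu> p" and r: "r > 0"
  shows "in_Lp p lborel (\<lambda>z. emeasure \<mu> (ball z r))"
proof -
  obtain \<Phi> :: "complex^'n \<Rightarrow> ennreal" and \<kappa> :: real where \<kappa>: "\<kappa> > 0"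
    and [measurable]: "\<Phi> \<in> borel_measurable borel" and \<Phi>_fin: "(\<integral>\<^sup>+z. \<Phi> z \<partial>lborel) < \<infinity>"
    and \<Phi>: "\<And>y z. norm (y - z) \<le> 1 \<Longrightarrow> ennreal ((\<kappa> * (berezin y * gauss \<alpha> y)) powr p) \<le> \<Phi> z"
    by (rule berezin_powr_dominated[OF p T], rule that)
  define R where "R = 6 * r + 1 + 2 * \<alpha>"
  define Q where "Q = 4 * exp ((r + 1)\<^sup>2 / \<alpha>)"
  define A where "A = (2 * Q / \<kappa>) powr p"
  define m where "m z = enn2real (emeasure \<mu> (ball z r))" for z
  define M where "M = enn2real (emeasure \<mu> (ball 0 (R + r)))"
  have [measurable]: "ball (0::complex^'n) R \<in> sets borel" by simp
  have bound: "ennreal (m z powr p) \<le> ennreal (M powr p) * indicator (ball 0 R) z + ennreal A * \<Phi> z" for z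
  proof (cases "norm z < R")
    case True
    have "ball z r \<subseteq> ball 0 (R + r)"
      using True by (intro ball_subset_ball_iff[THEN iffD2]) (auto simp: dist_norm)
    then have "emeasure \<mu> (ball z r) \<le> emeasure \<mu> (ball 0 (R + r))"
      by (intro emeasure_mono) (simp_all add: sets_\<mu>)
    then have "m z \<le> M"
      unfolding m_def M_def using emeasure_ball_finite by (intro enn2real_mono) simp_all
    then have "m z powr p \<le> M powr p"
      using p by (intro powr_mono2) (auto simp: m_def)
    then have "ennreal (m z powr p) \<le> ennreal (M powr p)"
      by (rule ennreal_leI)
    then show ?thesis
      using True by (simp add: add_increasing2)
  next
    case False
    then have "norm z \<ge> 6 * r + 1 + 2 * \<alpha>"
      by (simp add: R_def)
    then obtain y where y: "norm (y - z) \<le> 1"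
      and le: "emeasure \<mu> (ball z r) \<le> ennreal (Q * (berezin z * gauss \<alpha> z + berezin y * gauss \<alpha> y))"
      using emeasure_ball_le_berezin[OF r] unfolding Q_def by blast
    let ?b = "\<lambda>x. berezin x * gauss \<alpha> x"
    have b: "?b x \<ge> 0" for x
      using berezin_nonneg[of x] by simp
    have Q: "Q > 0" by (simp add: Q_def)
    \<comment> \<open>\<open>x\<close> is whichever of \<open>z\<close> and \<open>y\<close> has the
      larger weighted transform. Twice the maximum replaces the sum, so one use of the dominating
      function suffices and no p-th power of a sum has to be split.\<close>
    obtain x where x: "norm (x - z) \<le> 1" "?b z \<le> ?b x" "?b y \<le> ?b x"
      using y by (metis diff_self linear norm_zero zero_le_one)
    have "m z \<le> Q * (?b z + ?b y)"
      unfolding m_def using le b Q by (intro enn2real_leI) auto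
    also have "\<dots> \<le> Q * (2 * ?b x)"
      using x Q by (intro mult_left_mono) auto
    also have "\<dots> = (2 * Q / \<kappa>) * (\<kappa> * ?b x)"
      using \<kappa> by simp
    finally have "m z powr p \<le> ((2 * Q / \<kappa>) * (\<kappa> * ?b x)) powr p"
      using p by (intro powr_mono2) (auto simp: m_def)
    also have "\<dots> = A * (\<kappa> * ?b x) powr p"
      unfolding A_def by (rule powr_mult)
    finally have "ennreal (m z powr p) \<le> ennreal A * ennreal ((\<kappa> * ?b x) powr p)"
      by (simp add: ennreal_mult[symmetric] A_def ennreal_leI)
    also have "\<dots> \<le> ennreal A * \<Phi> z"
      by (intro mult_left_mono \<Phi> x zero_le)
    finally show ?thesis
      by (simp add: add_increasing)
  qed
  have "(\<integral>\<^sup>+z. ennreal (m z powr p) \<partial>lborel) \<le>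
      (\<integral>\<^sup>+z. ennreal (M powr p) * indicator (ball 0 R) z + ennreal A * \<Phi> z \<partial>lborel)"
    by (intro nn_integral_mono bound)
  also have "\<dots> = ennreal (M powr p) * emeasure lborel (ball (0::complex^'n) R) + ennreal A * (\<integral>\<^sup>+z. \<Phi> z \<partial>lborel)"
    by (subst nn_integral_add) (auto simp: nn_integral_cmult nn_integral_cmult_indicator)
  also have "\<dots> < \<infinity>"
    using \<Phi>_fin emeasure_lborel_ball_finite[of "0::complex^'n" R] by (simp add: ennreal_mult_less_top)
  finally show ?thesis
    using emeasure_ball_measurable emeasure_ball_finite by (simp add: in_Lp_def m_def)
qed

end

theorem proposition3p5:
  fixes \<alpha> p :: real and \<mu> :: "(complex^'n::finite) measure"
  assumes "\<alpha> > 0" and "p \<ge> 1"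
    and "sets \<mu> = sets borel"
    and "\<And>z. (\<integral>\<^sup>+w. ennreal ((norm (K_ph \<alpha> z w))\<^sup>2 * exp (- (norm w)\<^sup>2 / \<alpha>)) \<partial>\<mu>) < \<infinity>"
    and "toeplitz_in_schatten \<alpha> \<mu> p"
  shows "\<forall>r>0. in_Lp p lborel (\<lambda>z. emeasure \<mu> (ball z r))"
proof -
  interpret kernel_measure \<alpha> \<mu>
    using assms by unfold_locales
  show ?thesis
    using in_Lp_emeasure_ball assms by blast
qed

end
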